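(* Let $K$ be a field containing an element of multiplicative order $6$. Then $\beta_{\mathrm{sep}}^K(\mathrm{A}_4\times \mathrm{C}_2)=6$, where $\mathrm{A}_4$ is the alternating group of degree $4$ and $\mathrm{C}_2$ is the group of order $2$.
   Context: Let $K$ be a field and $G$ a finite group with $\mathrm{char}(K)\nmid |G|$. For a finite dimensional $KG$-module $V$, $K[V]$ is the polynomial ring in the coordinate functions on $V$, on which $G$ acts by $(g\cdot f)(v)=f(g^{-1}v)$, and $K[V]^G$ is the subalgebra of $G$-invariants. A subset $S\subseteq K[V]^G$ is a separating set if whenever $v,w\in V$ have different $G$-orbits, there is $f\in S$ with $f(v)\ne f(w)$. The number $\beta_{\mathrm{sep}}(G,V)$ is the minimal positive integer $d$ such that the elements of $K[V]^G$ of degree at most $d$ form a separating set, and $\beta_{\mathrm{sep}}^K(G)$ is the supremum of $\beta_{\mathrm{sep}}(G,V)$ over all finite dimensional $KG$-modules $V$. *)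

theory Defs
  imports
    "HOL-Library.Poly_Mapping"
    "HOL-Library.Extended_Nat"
    "HOL-Algebra.Sym_Groups"
    "HOL-Algebra.Elementary_Groups"
    "HOL-Algebra.Group_Action"
    "Jordan_Normal_Form.Matrix"
begin

text \<open>
  A finite dimensional \<open>KG\<close>-module is given, after choosing a basis, by its dimension \<open>n\<close>
  (possibly \<open>0\<close>) and a homomorphism \<open>\<rho>\<close> from \<open>G\<close> to the group of invertible \<open>n \<times> n\<close> matrices
  over \<open>K\<close>; the underlying space is \<open>carrier_vec n\<close>.
\<close>

definition matrix_rep :: "'g monoid \<Rightarrow> nat \<Rightarrow> ('g \<Rightarrow> 'k::field mat) \<Rightarrow> bool"
  where "matrix_rep G n \<rho> \<longleftrightarrow> \<rho> \<in> hom G (units_of (ring_mat TYPE('k) n ()))"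

text \<open>
  Formal polynomials in the variables \<open>X\<^sub>0, X\<^sub>1, \<dots>\<close> (for finite \<open>K\<close> these must not be confused with
  polynomial functions): finitely supported maps from monomials to coefficients, a monomial being
  a finitely supported exponent map.
\<close>

type_synonym 'k mpoly = "(nat \<Rightarrow>\<^sub>0 nat) \<Rightarrow>\<^sub>0 'k"

definition mconst :: "'k::zero \<Rightarrow> 'k mpoly"
  where "mconst a = Poly_Mapping.single 0 a"

definition mvar :: "nat \<Rightarrow> 'k::zero_neq_one mpoly"
  where "mvar i = Poly_Mapping.single (Poly_Mapping.single i 1) 1"

text \<open>
  \<open>mpoly_subst c x p\<close> is the value of \<open>p\<close> at \<open>X\<^sub>i = x i\<close> in a \<open>K\<close>-algebra with structure map \<open>c\<close>.
\<close>

definition mpoly_subst :: "('k::zero \<Rightarrow> 'r::comm_ring_1) \<Rightarrow> (nat \<Rightarrow> 'r) \<Rightarrow> 'k mpoly \<Rightarrow> 'r"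
  where "mpoly_subst c x p =
    (\<Sum>m\<in>Poly_Mapping.keys p.
       c (Poly_Mapping.lookup p m) * (\<Prod>i\<in>Poly_Mapping.keys m. x i ^ Poly_Mapping.lookup m i))"

definition mpoly_eval :: "'k::field vec \<Rightarrow> 'k mpoly \<Rightarrow> 'k"
  where "mpoly_eval v p = mpoly_subst (\<lambda>a. a) (\<lambda>i. v $ i) p"

definition monom_degree :: "(nat \<Rightarrow>\<^sub>0 nat) \<Rightarrow> nat"
  where "monom_degree m = (\<Sum>i\<in>Poly_Mapping.keys m. Poly_Mapping.lookup m i)"

text \<open>The zero polynomial gets degree \<open>0\<close>.\<close>

definition total_degree :: "'k::zero mpoly \<Rightarrow> nat"
  where "total_degree p = Max (insert 0 (monom_degree ` Poly_Mapping.keys p))"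

text \<open>\<open>K[V]\<close> for \<open>V = K\<^sup>n\<close>, the variable \<open>X\<^sub>i\<close> being the \<open>i\<close>-th coordinate function.\<close>

definition coord_ring :: "nat \<Rightarrow> 'k::zero mpoly set"
  where "coord_ring n = {p. \<forall>m\<in>Poly_Mapping.keys p. Poly_Mapping.keys m \<subseteq> {..<n}}"

text \<open>
  The action \<open>(g \<cdot> f)(v) = f (g\<^sup>-\<^sup>1 v)\<close> on formal polynomials: each coordinate function \<open>X\<^sub>i\<close> is
  replaced by the linear form \<open>v \<mapsto> (g\<^sup>-\<^sup>1 v)\<^sub>i\<close>.
\<close>

definition poly_act ::
    "'g monoid \<Rightarrow> nat \<Rightarrow> ('g \<Rightarrow> 'k::field mat) \<Rightarrow> 'g \<Rightarrow> 'k mpoly \<Rightarrow> 'k mpoly"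
  where "poly_act G n \<rho> g f =
    mpoly_subst mconst (\<lambda>i. \<Sum>j<n. mconst (\<rho> (inv\<^bsub>G\<^esub> g) $$ (i, j)) * mvar j) f"

definition invariant_ring :: "'g monoid \<Rightarrow> nat \<Rightarrow> ('g \<Rightarrow> 'k::field mat) \<Rightarrow> 'k mpoly set"
  where "invariant_ring G n \<rho> = {f \<in> coord_ring n. \<forall>g\<in>carrier G. poly_act G n \<rho> g f = f}"

abbreviation vec_orbit :: "'g monoid \<Rightarrow> ('g \<Rightarrow> 'k::field mat) \<Rightarrow> 'k vec \<Rightarrow> 'k vec set"
  where "vec_orbit G \<rho> v \<equiv> orbit G (\<lambda>g w. \<rho> g *\<^sub>v w) v"

definition separating_set ::
    "'g monoid \<Rightarrow> nat \<Rightarrow> ('g \<Rightarrow> 'k::field mat) \<Rightarrow> 'k mpoly set \<Rightarrow> bool"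
  where "separating_set G n \<rho> S \<longleftrightarrow>
    S \<subseteq> invariant_ring G n \<rho> \<and>
    (\<forall>v\<in>carrier_vec n. \<forall>w\<in>carrier_vec n.
       vec_orbit G \<rho> v \<noteq> vec_orbit G \<rho> w \<longrightarrow> (\<exists>f\<in>S. mpoly_eval v f \<noteq> mpoly_eval w f))"

text \<open>
  The infimum in \<^typ>\<open>enat\<close> of a nonempty set is its minimum; it would be \<open>\<infinity>\<close> if no degree bound
  sufficed.
\<close>

definition beta_sep :: "'g monoid \<Rightarrow> nat \<Rightarrow> ('g \<Rightarrow> 'k::field mat) \<Rightarrow> enat"
  where "beta_sep G n \<rho> =
    Inf {enat d | d. 0 < d \<and> separating_set G n \<rho> {f \<in> invariant_ring G n \<rho>. total_degree f \<le> d}}"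

definition beta_sep_field :: "'k::field itself \<Rightarrow> 'g monoid \<Rightarrow> enat"
  where "beta_sep_field _ G =
    Sup {beta_sep G n \<rho> | n (\<rho> :: 'g \<Rightarrow> 'k mat). matrix_rep G n \<rho>}"

definition has_mult_order :: "'k::field \<Rightarrow> nat \<Rightarrow> bool"
  where "has_mult_order x k \<longleftrightarrow> 0 < k \<and> x ^ k = 1 \<and> (\<forall>m. 0 < m \<and> m < k \<longrightarrow> x ^ m \<noteq> 1)"

end

theory Submission
  imports Defs
begin

text \<open>
  Lower bound: if \<open>G = A\<^sub>4 \<times> C\<^sub>2\<close> acts on a line through a character of order \<open>6\<close>, then all
  invariants of degree less than \<open>6\<close> are constant.

  Upper bound: let \<open>v\<close> and \<open>v'\<close> agree on all invariants of degree at most \<open>6\<close>, let \<open>A\<close> be the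
  Sylow \<open>2\<close>-subgroup of \<open>G\<close> and \<open>c\<close> an element of order \<open>3\<close>. The linear forms on \<open>V\<close> are sums of
  eigenvectors of \<open>A\<close>, and such an eigenvector \<open>\<phi>\<close> is known on the orbit of \<open>v\<close> from the triple of
  its values at \<open>v\<close>, \<open>c v\<close>, \<open>c\<^sup>2 v\<close>. So \<open>v\<close> becomes a family of triples, on which \<open>A\<close> acts by signs
  and \<open>c\<close> by rotation. As \<open>C\<^sub>3\<close> has Noether number \<open>3\<close>, after a rotation \<open>v\<close> and \<open>v'\<close> agree on all
  \<open>A\<close>-invariants of degree at most \<open>2\<close>, so that every eigenvector takes the same values at \<open>v\<close> and
  \<open>v'\<close> up to a sign depending only on its character. The nontrivial characters of \<open>A\<close> form a Fano
  plane, and if the signs do not come from an element of \<open>A\<close>, then a monomial of degree \<open>3\<close> or \<open>4\<close>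
  supported on a line or on the complement of a line changes its sign from \<open>v\<close> to \<open>v'\<close>. When that
  support is rotation-invariant, this contradicts the agreement on an invariant of degree \<open>3\<close> or \<open>6\<close>.
  Otherwise, if some \<open>A\<close>-invariant of degree at most \<open>2\<close> is not constant under rotation, multiplying
  the monomial by it shows that all three rotations of the monomial change their sign, and then so
  does a monomial with rotation-invariant support. If there is no such \<open>A\<close>-invariant, all triples
  are constant up to signs, and \<open>v\<close> and \<open>v'\<close> can be compared directly.
\<close>

section \<open>Substitution and degree of polynomials\<close>

definition monom_value :: "(nat \<Rightarrow> 'r::comm_ring_1) \<Rightarrow> (nat \<Rightarrow>\<^sub>0 nat) \<Rightarrow> 'r"
  where "monom_value x m = (\<Prod>i\<in>Poly_Mapping.keys m. x i ^ Poly_Mapping.lookup m i)"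

lemma monom_value_superset:
  assumes "finite A" "Poly_Mapping.keys m \<subseteq> A"
  shows "monom_value x m = (\<Prod>i\<in>A. x i ^ Poly_Mapping.lookup m i)"
  unfolding monom_value_def
  by (rule prod.mono_neutral_left) (use assms in \<open>auto simp: in_keys_iff\<close>)

lemma monom_value_zero [simp]: "monom_value x 0 = 1"
  by (simp add: monom_value_def)

lemma monom_value_single [simp]: "monom_value x (Poly_Mapping.single i k) = x i ^ k"
  by (simp add: monom_value_def)

lemma monom_value_add: "monom_value x (m + m') = monom_value x m * monom_value x m'"
proof -
  let ?A = "Poly_Mapping.keys m \<union> Poly_Mapping.keys m'"
  have "monom_value x (m + m') = (\<Prod>i\<in>?A. x i ^ Poly_Mapping.lookup (m + m') i)"
    by (rule monom_value_superset) (simp_all add: Poly_Mapping.keys_add)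
  also have "\<dots> = (\<Prod>i\<in>?A. x i ^ Poly_Mapping.lookup m i) * (\<Prod>i\<in>?A. x i ^ Poly_Mapping.lookup m' i)"
    by (simp add: lookup_add power_add prod.distrib)
  also have "\<dots> = monom_value x m * monom_value x m'"
    by (simp add: monom_value_superset[symmetric])
  finally show ?thesis .
qed

lemma mpoly_subst_eq:
  "mpoly_subst c x p =
    (\<Sum>m\<in>Poly_Mapping.keys p. c (Poly_Mapping.lookup p m) * monom_value x m)"
  by (simp add: mpoly_subst_def monom_value_def)

lemma poly_mapping_sum_single:
  "p = (\<Sum>m\<in>Poly_Mapping.keys p. Poly_Mapping.single m (Poly_Mapping.lookup p m))"
  by (rule poly_mapping_eqI)
    (auto simp: lookup_sum lookup_single when_def in_keys_iff intro: sum.neutral)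

text \<open>Evaluation at a point is the case where \<open>c\<close> is the identity, and the group
  action is the case of \<open>mconst\<close>. Hence \<open>subst_subst\<close> covers both the
  value of a transformed polynomial and the composition of two transformations.\<close>

locale coeff_hom =
  fixes c :: "'k::field \<Rightarrow> 'r::comm_ring_1"
  assumes zero: "c 0 = 0"
    and one: "c 1 = 1"
    and add: "c (a + b) = c a + c b"
    and mult: "c (a * b) = c a * c b"
begin

lemma subst_superset:
  assumes "finite A" "Poly_Mapping.keys p \<subseteq> A"
  shows "mpoly_subst c x p = (\<Sum>m\<in>A. c (Poly_Mapping.lookup p m) * monom_value x m)"
  unfolding mpoly_subst_eq
  by (rule sum.mono_neutral_left) (use assms in \<open>auto simp: in_keys_iff zero\<close>)

lemma subst_single [simp]: "mpoly_subst c x (Poly_Mapping.single m a) = c a * monom_value x m"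
  by (simp add: mpoly_subst_eq zero)

lemma subst_zero [simp]: "mpoly_subst c x 0 = 0"
  by (simp add: mpoly_subst_eq)

lemma subst_const [simp]: "mpoly_subst c x (mconst a) = c a"
  by (simp add: mconst_def)

lemma subst_var [simp]: "mpoly_subst c x (mvar i) = x i"
  by (simp add: mvar_def one)

lemma subst_add [simp]: "mpoly_subst c x (p + q) = mpoly_subst c x p + mpoly_subst c x q"
proof -
  let ?A = "Poly_Mapping.keys p \<union> Poly_Mapping.keys q"
  have "mpoly_subst c x (p + q) = (\<Sum>m\<in>?A. c (Poly_Mapping.lookup (p + q) m) * monom_value x m)"
    by (rule subst_superset) (simp_all add: Poly_Mapping.keys_add)
  also have "\<dots> = (\<Sum>m\<in>?A. c (Poly_Mapping.lookup p m) * monom_value x m)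
      + (\<Sum>m\<in>?A. c (Poly_Mapping.lookup q m) * monom_value x m)"
    by (simp add: lookup_add add distrib_right sum.distrib)
  also have "\<dots> = mpoly_subst c x p + mpoly_subst c x q"
    by (simp add: subst_superset[symmetric])
  finally show ?thesis .
qed

lemma subst_sum: "mpoly_subst c x (\<Sum>i\<in>I. f i) = (\<Sum>i\<in>I. mpoly_subst c x (f i))"
  by (induction I rule: infinite_finite_induct) simp_all

lemma subst_mult [simp]: "mpoly_subst c x (p * q) = mpoly_subst c x p * mpoly_subst c x q"
proof -
  let ?s = "\<lambda>p m. Poly_Mapping.single m (Poly_Mapping.lookup p m)"
  have "p * q = (\<Sum>m\<in>Poly_Mapping.keys p. ?s p m) * (\<Sum>m\<in>Poly_Mapping.keys q. ?s q m)"
    by (intro arg_cong2[where f="(*)"] poly_mapping_sum_single)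
  also have "\<dots> = (\<Sum>m\<in>Poly_Mapping.keys p. \<Sum>m'\<in>Poly_Mapping.keys q. ?s p m * ?s q m')"
    by (rule sum_product)
  also have "mpoly_subst c x \<dots> = (\<Sum>m\<in>Poly_Mapping.keys p. \<Sum>m'\<in>Poly_Mapping.keys q.
      (c (Poly_Mapping.lookup p m) * monom_value x m) * (c (Poly_Mapping.lookup q m') * monom_value x m'))"
    by (simp add: subst_sum mult_single monom_value_add mult mult.assoc mult.left_commute)
  also have "\<dots> = mpoly_subst c x p * mpoly_subst c x q"
    unfolding mpoly_subst_eq by (rule sum_product[symmetric])
  finally show ?thesis .
qed

lemma subst_one [simp]: "mpoly_subst c x 1 = 1"
  by (simp add: mpoly_subst_eq one)

lemma subst_power: "mpoly_subst c x (p ^ k) = mpoly_subst c x p ^ k"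
  by (induction k) simp_all

lemma subst_prod: "mpoly_subst c x (\<Prod>i\<in>I. f i) = (\<Prod>i\<in>I. mpoly_subst c x (f i))"
  by (induction I rule: infinite_finite_induct) (simp_all add: subst_one)

lemma subst_subst:
  "mpoly_subst c x (mpoly_subst mconst y p) = mpoly_subst c (\<lambda>i. mpoly_subst c x (y i)) p"
  by (simp add: mpoly_subst_def[of mconst] mpoly_subst_def[of c "\<lambda>i. mpoly_subst c x (y i)"]
      subst_sum subst_prod subst_power)

end

lemma mpoly_subst_cong:
  assumes "p \<in> coord_ring n" "\<And>i. i < n \<Longrightarrow> x i = y i"
  shows "mpoly_subst c x p = mpoly_subst c y p"
  unfolding mpoly_subst_def
  by (intro sum.cong prod.cong arg_cong2[where f="(*)"] refl arg_cong2[where f="(^)"])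
    (use assms in \<open>auto simp: coord_ring_def\<close>)

interpretation eval_hom: coeff_hom "\<lambda>a::'k::field. a"
  by unfold_locales simp_all

interpretation mconst_hom: coeff_hom "mconst :: 'k::field \<Rightarrow> 'k mpoly"
  by unfold_locales (simp_all add: mconst_def single_add mult_single)

section \<open>Polynomials of bounded degree\<close>

definition mpolys_le :: "nat \<Rightarrow> nat \<Rightarrow> 'k::zero mpoly set"
  where "mpolys_le n d = {p \<in> coord_ring n. total_degree p \<le> d}"

lemma mpolys_le_iff:
  "p \<in> mpolys_le n d \<longleftrightarrow>
    (\<forall>m\<in>Poly_Mapping.keys p. Poly_Mapping.keys m \<subseteq> {..<n} \<and> monom_degree m \<le> d)"
  unfolding mpolys_le_def coord_ring_def total_degree_def by auto

lemma monom_degree_superset: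
  assumes "finite A" "Poly_Mapping.keys m \<subseteq> A"
  shows "monom_degree m = (\<Sum>i\<in>A. Poly_Mapping.lookup m i)"
  unfolding monom_degree_def
  by (rule sum.mono_neutral_left) (use assms in \<open>auto simp: in_keys_iff\<close>)

lemma monom_degree_add: "monom_degree (m + m') = monom_degree m + monom_degree m'"
proof -
  let ?A = "Poly_Mapping.keys m \<union> Poly_Mapping.keys m'"
  have "monom_degree (m + m') = (\<Sum>i\<in>?A. Poly_Mapping.lookup (m + m') i)"
    by (rule monom_degree_superset) (simp_all add: Poly_Mapping.keys_add)
  also have "\<dots> = (\<Sum>i\<in>?A. Poly_Mapping.lookup m i) + (\<Sum>i\<in>?A. Poly_Mapping.lookup m' i)"
    by (simp add: lookup_add sum.distrib)
  also have "\<dots> = monom_degree m + monom_degree m'"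
    by (simp add: monom_degree_superset[symmetric])
  finally show ?thesis .
qed

lemma mpolys_le_mono: "p \<in> mpolys_le n d \<Longrightarrow> d \<le> e \<Longrightarrow> p \<in> mpolys_le n e"
  by (auto simp: mpolys_le_iff)

lemma mpolys_le_zero [simp]: "0 \<in> mpolys_le n d"
  by (simp add: mpolys_le_iff)

lemma mpolys_le_const [simp]: "mconst a \<in> mpolys_le n d"
  by (simp add: mpolys_le_iff mconst_def monom_degree_def)

lemma mpolys_le_one [simp]: "1 \<in> mpolys_le n d"
  by (simp add: mpolys_le_iff monom_degree_def)

lemma mpolys_le_var: "i < n \<Longrightarrow> mvar i \<in> mpolys_le n 1"
  by (simp add: mpolys_le_iff mvar_def monom_degree_def)

lemma mpolys_le_add: "p \<in> mpolys_le n d \<Longrightarrow> q \<in> mpolys_le n d \<Longrightarrow> p + q \<in> mpolys_le n d"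
  unfolding mpolys_le_iff using Poly_Mapping.keys_add[of p q] by blast

lemma mpolys_le_sum: "(\<And>i. i \<in> I \<Longrightarrow> f i \<in> mpolys_le n d) \<Longrightarrow> (\<Sum>i\<in>I. f i) \<in> mpolys_le n d"
  by (induction I rule: infinite_finite_induct) (simp_all add: mpolys_le_add)

lemma mpolys_le_mult:
  assumes "p \<in> mpolys_le n d" "q \<in> mpolys_le n e"
  shows "p * q \<in> mpolys_le n (d + e)"
  unfolding mpolys_le_iff
proof
  fix m assume "m \<in> Poly_Mapping.keys (p * q)"
  then obtain a b where ab: "m = a + b" "a \<in> Poly_Mapping.keys p" "b \<in> Poly_Mapping.keys q"
    using Poly_Mapping.keys_mult[of p q] by blast
  then show "Poly_Mapping.keys m \<subseteq> {..<n} \<and> monom_degree m \<le> d + e"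
    using assms Poly_Mapping.keys_add[of a b] unfolding mpolys_le_iff
    by (fastforce simp: monom_degree_add intro: add_mono)
qed

lemma mpolys_le_power: "p \<in> mpolys_le n d \<Longrightarrow> p ^ k \<in> mpolys_le n (k * d)"
  by (induction k) (simp_all add: mpolys_le_mult)

lemma mpolys_le_prod:
  "(\<And>i. i \<in> I \<Longrightarrow> f i \<in> mpolys_le n (d i)) \<Longrightarrow> (\<Prod>i\<in>I. f i) \<in> mpolys_le n (\<Sum>i\<in>I. d i)"
  by (induction I rule: infinite_finite_induct) (simp_all add: mpolys_le_mult)

lemma mpolys_le_subst:
  assumes p: "p \<in> mpolys_le n d" and x: "\<And>i. i < n \<Longrightarrow> x i \<in> mpolys_le n 1"
  shows "mpoly_subst mconst x p \<in> mpolys_le n d"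
  unfolding mpoly_subst_def
proof (rule mpolys_le_sum)
  fix m assume m: "m \<in> Poly_Mapping.keys p"
  have "(\<Prod>i\<in>Poly_Mapping.keys m. x i ^ Poly_Mapping.lookup m i) \<in> mpolys_le n (monom_degree m)"
    unfolding monom_degree_def
  proof (rule mpolys_le_prod)
    fix i assume "i \<in> Poly_Mapping.keys m"
    then have "i < n" using p m by (auto simp: mpolys_le_iff)
    from mpolys_le_power[OF x[OF this], of "Poly_Mapping.lookup m i"]
    show "x i ^ Poly_Mapping.lookup m i \<in> mpolys_le n (Poly_Mapping.lookup m i)" by simp
  qed
  then show "mconst (Poly_Mapping.lookup p m) *
      (\<Prod>i\<in>Poly_Mapping.keys m. x i ^ Poly_Mapping.lookup m i) \<in> mpolys_le n d"
    using mpolys_le_mult[OF mpolys_le_const[of _ n 0]] p m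
    by (metis (no_types, lifting) add_0 mpolys_le_iff mpolys_le_mono)
qed

section \<open>Sign patterns\<close>

text \<open>Signs are stored as booleans: their product is then \<open>\<noteq>\<close>, and
  relations between signs become propositional and are left to \<open>satx\<close>.\<close>

definition sg :: "bool \<Rightarrow> 'k::comm_ring_1"
  where "sg b = (if b then - 1 else 1)"

lemma sg_simps [simp]: "sg False = 1" "sg True = - 1"
  by (simp_all add: sg_def)

lemma sg_nonzero [simp]: "sg b \<noteq> (0::'k::field)"
  by (simp add: sg_def)

lemma sg_mult_left: "sg a * (sg b * x) = sg (a \<noteq> b) * x"
  by (simp add: sg_def)

text \<open>Comparing a pair with itself gives equal squares, so one nonzero \<open>x\<close> fixes
  the sign; comparing any other pair with this one forces the same sign there. If every
  \<open>x\<close> is 0, so is every \<open>x'\<close>.\<close>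

lemma sign_exists:
  fixes D :: "'k::field \<Rightarrow> 'k \<Rightarrow> bool"
  assumes "\<And>x x' y y'. D x x' \<Longrightarrow> D y y' \<Longrightarrow> x * y = x' * y'"
  shows "\<exists>b. \<forall>x x'. D x x' \<longrightarrow> x' = sg b * x"
proof (cases "\<exists>x x'. D x x' \<and> x \<noteq> 0")
  case False
  have "x' = sg False * x" if "D x x'" for x x'
    using assms[OF that that] False that by auto
  then show ?thesis by blast
next
  case True
  then obtain x x' where x: "D x x'" "x \<noteq> 0" by blast
  have "(x' - x) * (x' + x) = 0"
    using assms[OF x(1) x(1)] by (simp add: algebra_simps)
  then have "x' = x \<or> x' = - x"
    by (simp add: eq_neg_iff_add_eq_0)
  then obtain b where b: "x' = sg b * x"
    by (metis mult_1 mult_minus_left sg_simps)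
  have "y' = sg b * y" if "D y y'" for y y'
  proof -
    have "x * y = sg b * x * y'"
      using assms[OF x(1) that] b by simp
    then have "y = sg b * y'"
      using x(2) by (simp add: mult.commute mult.left_commute)
    then show ?thesis
      by (simp add: sg_mult_left)
  qed
  then show ?thesis by blast
qed

text \<open>The sum of three signs is 3, 1, -1 or -3. These differ by 2, 4 or 6, so the sum
  determines the number of minus signs. The conclusion records this number through its parity and
  whether it is 3 or 0.\<close>

lemma sum_sg_eq:
  assumes "(2::'k::field) \<noteq> 0" "(3::'k) \<noteq> 0"
    and "sg a0 + sg a1 + sg a2 = (sg b0 + sg b1 + sg b2 :: 'k)"
  shows "((a0 \<noteq> (a1 \<noteq> a2)) \<longleftrightarrow> (b0 \<noteq> (b1 \<noteq> b2))) \<and>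
    (a0 \<and> a1 \<and> a2 \<longleftrightarrow> b0 \<and> b1 \<and> b2) \<and> (a0 \<or> a1 \<or> a2 \<longleftrightarrow> b0 \<or> b1 \<or> b2)"
proof -
  have n: "(4::'k) \<noteq> 0" "(6::'k) \<noteq> 0"
    using assms(1,2) mult_eq_0_iff[of "2::'k" 2] mult_eq_0_iff[of "2::'k" 3] by simp_all
  have e: "(1::'k) + 1 + 1 = 3" "(1::'k) + 1 = 2" by simp_all
  have neq: "(3::'k) \<noteq> 1" "(3::'k) \<noteq> - 1" "(3::'k) \<noteq> - 3" "(1::'k) \<noteq> - 1" "(1::'k) \<noteq> - 3" "(- 1::'k) \<noteq> - 3"
    using assms(1,2) n by (simp_all add: eq_neg_iff_add_eq_0)
      (metis add_cancel_right_left add.commute assms(1) numeral_Bit1 numeral_One one_add_one is_num_normalize(1))+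
  show ?thesis
    using assms(3) neq
    by (cases a0; cases a1; cases a2; cases b0; cases b1; cases b2) (simp_all add: e)
qed

text \<open>
  The seven points of the Fano plane are \<open>p\<^sub>0, p\<^sub>1, p\<^sub>2, q\<^sub>0, q\<^sub>1, q\<^sub>2, y\<close>, and \<open>s\<^sub>i\<close>, \<open>t\<^sub>i\<close>, \<open>u\<close> are the
  signs attached to them (\<^const>\<open>True\<close> for \<open>- 1\<close>, so that \<open>\<noteq>\<close> is the product). The hypotheses run
  through the minimal linear dependencies, which are the lines and their complements.
\<close>

lemma fano_signs:
  assumes "p0 \<and> p1 \<and> p2 \<longrightarrow> \<not> (s0 \<noteq> (s1 \<noteq> s2))"
    and "q0 \<and> q1 \<and> q2 \<and> y \<longrightarrow> \<not> (t0 \<noteq> (t1 \<noteq> (t2 \<noteq> u)))"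
    and "p0 \<and> q1 \<and> q2 \<longrightarrow> \<not> (s0 \<noteq> (t1 \<noteq> t2))"
    and "p1 \<and> q2 \<and> q0 \<longrightarrow> \<not> (s1 \<noteq> (t2 \<noteq> t0))"
    and "p2 \<and> q0 \<and> q1 \<longrightarrow> \<not> (s2 \<noteq> (t0 \<noteq> t1))"
    and "p0 \<and> q0 \<and> y \<longrightarrow> \<not> (s0 \<noteq> (t0 \<noteq> u))"
    and "p1 \<and> q1 \<and> y \<longrightarrow> \<not> (s1 \<noteq> (t1 \<noteq> u))"
    and "p2 \<and> q2 \<and> y \<longrightarrow> \<not> (s2 \<noteq> (t2 \<noteq> u))"
    and "q0 \<and> p1 \<and> p2 \<and> y \<longrightarrow> \<not> (t0 \<noteq> (s1 \<noteq> (s2 \<noteq> u)))"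
    and "q1 \<and> p2 \<and> p0 \<and> y \<longrightarrow> \<not> (t1 \<noteq> (s2 \<noteq> (s0 \<noteq> u)))"
    and "q2 \<and> p0 \<and> p1 \<and> y \<longrightarrow> \<not> (t2 \<noteq> (s0 \<noteq> (s1 \<noteq> u)))"
    and "p0 \<and> q0 \<and> p1 \<and> q1 \<longrightarrow> \<not> (s0 \<noteq> (t0 \<noteq> (s1 \<noteq> t1)))"
    and "p1 \<and> q1 \<and> p2 \<and> q2 \<longrightarrow> \<not> (s1 \<noteq> (t1 \<noteq> (s2 \<noteq> t2)))"
    and "p2 \<and> q2 \<and> p0 \<and> q0 \<longrightarrow> \<not> (s2 \<noteq> (t2 \<noteq> (s0 \<noteq> t0)))"
  shows "\<exists>a0 a1 a2 d. \<not> (a0 \<noteq> (a1 \<noteq> a2)) \<and> (p0 \<longrightarrow> s0 = a0) \<and> (p1 \<longrightarrow> s1 = a1) \<and> (p2 \<longrightarrow> s2 = a2)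
    \<and> (q0 \<longrightarrow> t0 = (a0 \<noteq> d)) \<and> (q1 \<longrightarrow> t1 = (a1 \<noteq> d)) \<and> (q2 \<longrightarrow> t2 = (a2 \<noteq> d)) \<and> (y \<longrightarrow> u = d)"
  using assms
  by (simp only: ex_bool_eq) satx

text \<open>This serves the case of constant invariants. There the triples at v are the signs e_i
  and h_i times constants, s_i and t_i are the sign changes from v to v', and A_i and B_i are the
  signs of p_i q_(i+1) q_(i+2) at v and v'. Equal numbers of minus signs make B a rotation of A, say
  B_i = A_(i+k). With a_i = s_i e_i e_(i+k) this amounts to t_i h_i = d a_i h_(i+k), and the product
  of the a_i is 1 because that of the s_i is.\<close>

lemma rotate_signs:
  assumes "\<not> (s0 \<noteq> (s1 \<noteq> s2))" "\<not> e0" "\<not> h0"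
    and A: "A0 = (e0 \<noteq> (h1 \<noteq> h2))" "A1 = (e1 \<noteq> (h2 \<noteq> h0))" "A2 = (e2 \<noteq> (h0 \<noteq> h1))"
    and B: "B0 = (s0 \<noteq> (t1 \<noteq> (t2 \<noteq> A0)))" "B1 = (s1 \<noteq> (t2 \<noteq> (t0 \<noteq> A1)))" "B2 = (s2 \<noteq> (t0 \<noteq> (t1 \<noteq> A2)))"
    and "(A0 \<noteq> (A1 \<noteq> A2)) \<longleftrightarrow> (B0 \<noteq> (B1 \<noteq> B2))"
    and "A0 \<and> A1 \<and> A2 \<longleftrightarrow> B0 \<and> B1 \<and> B2" "A0 \<or> A1 \<or> A2 \<longleftrightarrow> B0 \<or> B1 \<or> B2"
    and d: "d = (t0 \<noteq> (t1 \<noteq> t2))"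
  shows "(\<exists>a0 a1 a2. \<not> (a0 \<noteq> (a1 \<noteq> a2)) \<and>
      (s0 \<noteq> e0) = (a0 \<noteq> e0) \<and> (s1 \<noteq> e1) = (a1 \<noteq> e1) \<and> (s2 \<noteq> e2) = (a2 \<noteq> e2) \<and>
      (t0 \<noteq> h0) = (d \<noteq> (a0 \<noteq> h0)) \<and> (t1 \<noteq> h1) = (d \<noteq> (a1 \<noteq> h1)) \<and> (t2 \<noteq> h2) = (d \<noteq> (a2 \<noteq> h2))) \<or>
    (\<exists>a0 a1 a2. \<not> (a0 \<noteq> (a1 \<noteq> a2)) \<and>
      (s0 \<noteq> e0) = (a0 \<noteq> e1) \<and> (s1 \<noteq> e1) = (a1 \<noteq> e2) \<and> (s2 \<noteq> e2) = (a2 \<noteq> e0) \<and>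
      (t0 \<noteq> h0) = (d \<noteq> (a0 \<noteq> h1)) \<and> (t1 \<noteq> h1) = (d \<noteq> (a1 \<noteq> h2)) \<and> (t2 \<noteq> h2) = (d \<noteq> (a2 \<noteq> h0))) \<or>
    (\<exists>a0 a1 a2. \<not> (a0 \<noteq> (a1 \<noteq> a2)) \<and>
      (s0 \<noteq> e0) = (a0 \<noteq> e2) \<and> (s1 \<noteq> e1) = (a1 \<noteq> e0) \<and> (s2 \<noteq> e2) = (a2 \<noteq> e1) \<and>
      (t0 \<noteq> h0) = (d \<noteq> (a0 \<noteq> h2)) \<and> (t1 \<noteq> h1) = (d \<noteq> (a1 \<noteq> h0)) \<and> (t2 \<noteq> h2) = (d \<noteq> (a2 \<noteq> h1)))"
  using assms
  by (simp only: ex_bool_eq) satx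

section \<open>Families of triples\<close>

text \<open>
  \<open>R a b e d x x'\<close> is to be read as follows: for a polynomial \<open>f\<close> of degree at most \<open>d\<close> on which
  the two generators of the Klein four-group and the generator of \<open>C\<^sub>2\<close> act by \<open>a\<close>, \<open>b\<close> and \<open>e\<close>,
  the sequences \<open>x\<close> and \<open>x'\<close> are \<open>f (c\<^sup>j v)\<close> and \<open>f (c\<^sup>j v')\<close>.
\<close>

locale sep_core =
  fixes w :: "'k::field"
    and R :: "'k \<Rightarrow> 'k \<Rightarrow> 'k \<Rightarrow> nat \<Rightarrow> (nat \<Rightarrow> 'k) \<Rightarrow> (nat \<Rightarrow> 'k) \<Rightarrow> bool"
  assumes two: "(2::'k) \<noteq> 0" and three: "(3::'k) \<noteq> 0" and root: "w\<^sup>2 + w + 1 = 0"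
    and const: "R 1 1 1 d (\<lambda>_. u) (\<lambda>_. u)"
    and add: "R a b e d f f' \<Longrightarrow> R a b e d g g' \<Longrightarrow>
      R a b e d (\<lambda>j. f j + g j) (\<lambda>j. f' j + g' j)"
    and mult: "R a b e d f f' \<Longrightarrow> R a2 b2 e2 d2 g g' \<Longrightarrow>
      R (a * a2) (b * b2) (e * e2) (d + d2) (\<lambda>j. f j * g j) (\<lambda>j. f' j * g' j)"
    and shift: "R a b e d f f' \<Longrightarrow> R b (a * b) e d (\<lambda>j. f (Suc j)) (\<lambda>j. f' (Suc j))"
    and period: "R a b e d f f' \<Longrightarrow> f (j + 3) = f j \<and> f' (j + 3) = f' j"
    and sum_eq: "R 1 1 1 6 f f' \<Longrightarrow> f 0 + f 1 + f 2 = f' 0 + f' 1 + f' 2"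
begin

lemma mono: "R a b e d f f' \<Longrightarrow> d \<le> d' \<Longrightarrow> R a b e d' f f'"
  using mult[OF const[of "d' - d" 1], of a b e d f f'] by simp

lemma scale: "R a b e d f f' \<Longrightarrow> R a b e d (\<lambda>j. u * f j) (\<lambda>j. u * f' j)"
  using mult[OF const[of 0 u], of a b e d f f'] by simp

lemma sum_eq_le: "R 1 1 1 d f f' \<Longrightarrow> d \<le> 6 \<Longrightarrow> f 0 + f 1 + f 2 = f' 0 + f' 1 + f' 2"
  using mono sum_eq by blast

lemma shift_n: "R 1 1 e d f f' \<Longrightarrow> R 1 1 e d (\<lambda>j. f (j + n)) (\<lambda>j. f' (j + n))"
proof (induction n)
  case (Suc n)
  from shift[OF Suc.IH[OF Suc.prems]] show ?case by simp
qed simp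

lemma period_simps:
  assumes "R a b e d f f'"
  shows "f 3 = f 0" "f 4 = f 1" "f' 3 = f' 0" "f' 4 = f' 1" "f 5 = f 2" "f' 5 = f' 2"
    "f (Suc (Suc (Suc j))) = f j" "f' (Suc (Suc (Suc j))) = f' j"
  using period[OF assms, of 0] period[OF assms, of 1] period[OF assms, of 2] period[OF assms, of j]
  by (simp_all add: numeral_eq_Suc)

section \<open>Fourier analysis on the group of order 3\<close>

definition fourier :: "'k \<Rightarrow> (nat \<Rightarrow> 'k) \<Rightarrow> 'k"
  where "fourier r f = f 0 + r * f 1 + r\<^sup>2 * f 2"

text \<open>For a cube root of unity \<open>r\<close> and a triple \<open>f\<close> this is 3 times
  a projection onto an eigenspace of the rotation: a shift by one multiplies it by r^2.\<close>

definition eigen :: "'k \<Rightarrow> (nat \<Rightarrow> 'k) \<Rightarrow> nat \<Rightarrow> 'k"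
  where "eigen r f j = f j + r * f (Suc j) + r\<^sup>2 * f (Suc (Suc j))"

lemma R_eigen:
  assumes "R 1 1 e d f f'"
  shows "R 1 1 e d (eigen r f) (eigen r f')"
proof -
  have "R 1 1 e d (\<lambda>j. f j + r * f (Suc j) + r\<^sup>2 * f (Suc (Suc j)))
      (\<lambda>j. f' j + r * f' (Suc j) + r\<^sup>2 * f' (Suc (Suc j)))"
    using shift_n[OF assms, of 1] shift_n[OF assms, of 2]
    by (intro add scale assms) simp_all
  then show ?thesis by (simp add: eigen_def[abs_def])
qed

lemma eigen_values:
  assumes "R a b e d f f'" "r ^ 3 = 1"
  shows "eigen r f 0 = fourier r f" "eigen r f 1 = r\<^sup>2 * fourier r f" "eigen r f 2 = r * fourier r f"
    "eigen r f' 0 = fourier r f'" "eigen r f' 1 = r\<^sup>2 * fourier r f'" "eigen r f' 2 = r * fourier r f'"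
proof -
  have r: "r * (r * r) = 1" using assms(2) by (simp add: power3_eq_cube mult.assoc)
  have r': "r * (r * (r * x)) = x" for x using r by (metis mult.assoc mult_1)
  show "eigen r f 0 = fourier r f" "eigen r f 1 = r\<^sup>2 * fourier r f" "eigen r f 2 = r * fourier r f"
    "eigen r f' 0 = fourier r f'" "eigen r f' 1 = r\<^sup>2 * fourier r f'" "eigen r f' 2 = r * fourier r f'"
    using period[OF assms(1), of 0] period[OF assms(1), of 1]
    by (simp_all add: eigen_def fourier_def numeral_2_eq_2 numeral_3_eq_3 algebra_simps r r')
qed

text \<open>Since r s t = 1, the product of the three eigenvectors is constant under rotation and
  contributes 3 times its value at 0. Its degree is 2 + 2 + 2 = 6, so the sums at v and v'
  agree.\<close>

lemma fourier_mult3: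
  assumes f: "R 1 1 1 2 f f'" and g: "R 1 1 1 2 g g'" and h: "R 1 1 1 2 h h'"
    and r: "r ^ 3 = 1" and s: "s ^ 3 = 1" and t: "t ^ 3 = 1" and rst: "r * s * t = 1"
  shows "fourier r f * fourier s g * fourier t h = fourier r f' * fourier s g' * fourier t h'"
proof -
  have three_times: "x + x + x = 3 * x" for x :: 'k
    by simp
  have rst': "r\<^sup>2 * s\<^sup>2 * t\<^sup>2 = 1"
    using rst by (metis power_mult_distrib power_one)
  have R: "R 1 1 1 (2 + 2 + 2) (\<lambda>j. eigen r f j * eigen s g j * eigen t h j)
      (\<lambda>j. eigen r f' j * eigen s g' j * eigen t h' j)"
    using mult[OF mult[OF R_eigen[OF f, of r] R_eigen[OF g, of s]] R_eigen[OF h, of t]] by simp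
  have e: "x + (r\<^sup>2 * a) * (s\<^sup>2 * b) * (t\<^sup>2 * c) + (r * a) * (s * b) * (t * c)
      = 3 * (a * b * c)" if "x = a * b * c" for x a b c
  proof -
    have "(r\<^sup>2 * a) * (s\<^sup>2 * b) * (t\<^sup>2 * c) = (r\<^sup>2 * s\<^sup>2 * t\<^sup>2) * (a * b * c)"
      and "(r * a) * (s * b) * (t * c) = (r * s * t) * (a * b * c)"
      by (simp_all only: ac_simps)
    then show ?thesis by (simp only: that rst rst' mult_1 three_times)
  qed
  have "3 * (fourier r f * fourier s g * fourier t h) = 3 * (fourier r f' * fourier s g' * fourier t h')"
    using sum_eq_le[OF R]
    by (simp only: eigen_values[OF f r] eigen_values[OF g s] eigen_values[OF h t] e)
  then show ?thesis using three by simp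
qed

lemma fourier_inversion:
  fixes r :: 'k
  assumes "r\<^sup>2 + r + 1 = 0"
  shows "fourier 1 f + fourier r f + fourier (r\<^sup>2) f = 3 * f 0"
proof -
  have r2: "r\<^sup>2 = - r - 1" using assms by (simp add: algebra_simps eq_neg_iff_add_eq_0)
  have "(r\<^sup>2)\<^sup>2 = (- r - 1)\<^sup>2" by (simp add: r2)
  also have "\<dots> = r\<^sup>2 + 2 * r + 1" by (simp add: power2_eq_square algebra_simps)
  finally have r4: "(r\<^sup>2)\<^sup>2 = r" by (simp add: r2)
  show ?thesis
    unfolding fourier_def r4 by (simp add: r2 algebra_simps)
qed

lemma cube_root:
  fixes r :: 'k
  assumes "r\<^sup>2 + r + 1 = 0"
  shows "r ^ 3 = 1" "(r\<^sup>2)\<^sup>2 + r\<^sup>2 + 1 = 0" "(r\<^sup>2)\<^sup>2 = r" "(r\<^sup>2) ^ 3 = 1" "r \<noteq> 1" "r \<noteq> 0" "r\<^sup>2 \<noteq> r" "r \<noteq> - 1"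
proof -
  have r2: "r\<^sup>2 = - r - 1" using assms by (simp add: algebra_simps eq_neg_iff_add_eq_0)
  have "r ^ 3 - 1 = (r - 1) * (r\<^sup>2 + r + 1)"
    by (simp add: algebra_simps power2_eq_square power3_eq_cube)
  then show r3: "r ^ 3 = 1" by (simp add: assms)
  have "(r\<^sup>2)\<^sup>2 = r ^ 3 * r" by (simp add: power2_eq_square power3_eq_cube)
  then show r4: "(r\<^sup>2)\<^sup>2 = r" using r3 by simp
  show "(r\<^sup>2)\<^sup>2 + r\<^sup>2 + 1 = 0" unfolding r4 using assms by (simp only: ac_simps)
  show "(r\<^sup>2) ^ 3 = 1" using r3 by (metis power_mult mult.commute power_one)
  show "r \<noteq> 1" using assms three by auto
  show "r \<noteq> 0" using assms by auto
  then show "r\<^sup>2 \<noteq> r" using \<open>r \<noteq> 1\<close> by (auto simp: power2_eq_square)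
  show "r \<noteq> - 1" using assms by auto
qed

text \<open>The cubes of the coefficients of \<open>t\<close> and \<open>t'\<close> agree, so these
  differ by a power of \<open>r\<close>. Comparing the triple products t t f and t f 1 shows that
  the coefficients of every \<open>f'\<close> arise from those of \<open>f\<close> by the matching
  powers, hence by one common rotation.\<close>

lemma align_step:
  assumes r: "r\<^sup>2 + r + 1 = 0" and t: "R 1 1 1 2 t t'" and nz: "fourier r t \<noteq> 0"
  shows "\<exists>m. \<forall>f f'. R 1 1 1 2 f f' \<longrightarrow> f' 0 = f m"
proof -
  note cr = cube_root[OF r]
  let ?x = "fourier r t" and ?y = "fourier r t'"
  have "?y * ?y * ?y = ?x * ?x * ?x"
    using fourier_mult3[OF t t t cr(1) cr(1) cr(1)] cr(1) by (simp add: power3_eq_cube)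
  moreover have "(?y - ?x) * ((?y - r * ?x) * (?y - r\<^sup>2 * ?x)) = ?y * ?y * ?y
      - (r\<^sup>2 + r + 1) * ?x * ?y * ?y + (r ^ 3 + r\<^sup>2 + r) * ?x * ?x * ?y - r ^ 3 * ?x * ?x * ?x"
    by (simp add: algebra_simps power2_eq_square power3_eq_cube)
  ultimately have "(?y - ?x) * ((?y - r * ?x) * (?y - r\<^sup>2 * ?x)) = 0"
    using r cr(1) by (simp add: ac_simps)
  then obtain k where k: "?y = r ^ k * ?x"
  proof -
    assume a: "\<And>k. ?y = r ^ k * ?x \<Longrightarrow> thesis"
    have "?y = r ^ 0 * ?x \<or> ?y = r ^ 1 * ?x \<or> ?y = r ^ 2 * ?x"
      using \<open>(?y - ?x) * ((?y - r * ?x) * (?y - r\<^sup>2 * ?x)) = 0\<close> by simp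
    then show thesis using a by blast
  qed
  have "r ^ k * (r ^ k * r ^ k) = (r ^ 3) ^ k"
    by (simp add: power3_eq_cube power_mult_distrib)
  then have r3k: "r ^ k * (r ^ k * r ^ k) = 1"
    by (simp add: cr(1))
  \<comment> \<open>A shift by \<open>2 * k\<close> multiplies the coefficient at \<open>r\<close>
    by (r^2)^(2k) = r^k, the factor found for \<open>t\<close>.\<close>
  have "f' 0 = f (2 * k)" if f: "R 1 1 1 2 f f'" for f f'
  proof -
    have "?x * ?x * fourier r f = ?y * ?y * fourier r f'"
      using fourier_mult3[OF t t f cr(1) cr(1) cr(1)] cr(1) by (simp add: power3_eq_cube)
    then have "?x * ?x * fourier r f = ?x * ?x * (r ^ k * r ^ k * fourier r f')"
      by (simp add: k ac_simps)
    then have "fourier r f = r ^ k * r ^ k * fourier r f'" using nz by simp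
    then have f1: "fourier r f' = r ^ k * fourier r f"
      using r3k by (metis mult.assoc mult_1)
    \<comment> \<open>The constant 1, with Fourier coefficient 3, is the third factor.\<close>
    have "?x * fourier (r\<^sup>2) f * fourier 1 (\<lambda>_. 1) = ?y * fourier (r\<^sup>2) f' * fourier 1 (\<lambda>_. 1)"
      using fourier_mult3[OF t f const[of 2 1] cr(1) cr(4)] cr(1)
      by (simp add: power3_eq_cube power2_eq_square ac_simps)
    then have "?x * fourier (r\<^sup>2) f = ?x * (r ^ k * fourier (r\<^sup>2) f')"
      using three by (simp add: fourier_def[of 1] k ac_simps)
    then have "fourier (r\<^sup>2) f = r ^ k * fourier (r\<^sup>2) f'" using nz by simp
    then have f2: "fourier (r\<^sup>2) f' = r ^ k * r ^ k * fourier (r\<^sup>2) f"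
      using r3k by (metis mult.assoc mult_1)
    have f0: "fourier 1 f' = fourier 1 f"
      using sum_eq_le[OF f] by (simp add: fourier_def)
    define g where "g i = (\<lambda>j. f (j + i))" for i
    have g: "fourier s (g i) = (s\<^sup>2) ^ i * fourier s f" if s: "s ^ 3 = 1" for s i
    proof (induction i)
      case (Suc i)
      have gi: "R 1 1 1 2 (g i) (\<lambda>j. f' (j + i))"
        unfolding g_def by (rule shift_n[OF f])
      have "fourier s (g (Suc i)) = eigen s (g i) 1"
        by (simp add: fourier_def eigen_def g_def numeral_2_eq_2)
      also have "\<dots> = s\<^sup>2 * fourier s (g i)" by (rule eigen_values[OF gi s])
      finally show ?case using Suc by simp
    qed (simp add: g_def)
    have "(r\<^sup>2) ^ (2 * k) = r ^ k"
      by (simp only: power_mult cr(3))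
    moreover have "((r\<^sup>2)\<^sup>2) ^ (2 * k) = r ^ k * r ^ k"
      by (simp only: cr(3) mult_2 power_add)
    ultimately have "3 * f' 0 = 3 * g (2 * k) 0"
      unfolding fourier_inversion[OF r, symmetric] g[OF cr(1)] g[OF cr(4)]
      using f0 f1 f2 by (simp add: g[of 1])
    then show ?thesis using three by (simp add: g_def)
  qed
  then show ?thesis by blast
qed

text \<open>
  A group of order \<open>3\<close> has Noether number \<open>3\<close>, so that the rotation-invariants of degree at most \<open>6\<close>
  separate the rotation-orbits of the values of the sign-invariants of degree at most \<open>2\<close>.
\<close>

lemma align:
  "\<exists>m. \<forall>f f' j. R 1 1 1 2 f f' \<longrightarrow> f' j = f (j + m)"
proof -
  have "\<exists>m. \<forall>f f'. R 1 1 1 2 f f' \<longrightarrow> f' 0 = f m"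
  proof (cases "\<exists>t t'. R 1 1 1 2 t t' \<and> (fourier w t \<noteq> 0 \<or> fourier (w\<^sup>2) t \<noteq> 0)")
    case True
    then show ?thesis
      using align_step[OF root] align_step[OF cube_root(2)[OF root]] by blast
  next
    case False
    have "f' 0 = f 0" if f: "R 1 1 1 2 f f'" for f f'
    proof -
      have z: "fourier w f = 0" "fourier (w\<^sup>2) f = 0" using False f by auto
      note cr = cube_root[OF root]
      have "fourier w f' * fourier w f' * fourier w f' = 0"
        using fourier_mult3[OF f f f cr(1) cr(1) cr(1)] z cr(1) by (simp add: power3_eq_cube)
      moreover have "fourier (w\<^sup>2) f' * fourier (w\<^sup>2) f' * fourier (w\<^sup>2) f' = 0"
        using fourier_mult3[OF f f f cr(4) cr(4) cr(4)] z cr(4) by (simp add: power3_eq_cube)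
      ultimately have "3 * f' 0 = 3 * f 0"
        unfolding fourier_inversion[OF root, symmetric] using z sum_eq_le[OF f]
        by (simp add: fourier_def[of 1])
      then show ?thesis using three by simp
    qed
    then show ?thesis by blast
  qed
  then obtain m where m: "\<And>f f'. R 1 1 1 2 f f' \<Longrightarrow> f' 0 = f m" by blast
  have "f' j = f (j + m)" if "R 1 1 1 2 f f'" for f f' j
    using m[OF shift_n[OF that, of j]] by (simp add: add.commute)
  then show ?thesis by blast
qed

text \<open>Using one \<open>f\<close> at all three places makes the product of its values invariant
  under rotation, as \<open>signs_ppp\<close> and \<open>signs_qqqy\<close> require.\<close>

lemma common_nonzero:
  assumes "\<exists>f f'. R a b e d f f' \<and> f i \<noteq> 0" "\<exists>f f'. R a b e d f f' \<and> f k \<noteq> 0"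
    "\<exists>f f'. R a b e d f f' \<and> f l \<noteq> 0"
  shows "\<exists>f f'. R a b e d f f' \<and> f i \<noteq> 0 \<and> f k \<noteq> 0 \<and> f l \<noteq> 0"
proof -
  obtain f f' g g' h h' where fgh: "R a b e d f f'" "f i \<noteq> 0" "R a b e d g g'" "g k \<noteq> 0"
    "R a b e d h h'" "h l \<noteq> 0"
    using assms by blast
  obtain p p' where p: "R a b e d p p'" "p i \<noteq> 0" "p k \<noteq> 0"
  proof (cases "f k = 0 \<and> g i = 0")
    case True
    then show thesis using that[OF add[OF fgh(1,3)]] fgh by simp
  next
    case False
    then show thesis using that fgh by blast
  qed
  show ?thesis
  proof (cases "p l = 0")
    case False
    then show ?thesis using p by blast
  next
    case True
    have uniq: "t = t'" if "p i \<noteq> 0" "p i + t * h i = 0" "p i + t' * h i = 0" for i t t'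
    proof -
      have "t * h i = t' * h i" using that(2,3) by (metis add_left_cancel)
      then show ?thesis using that(1,2) by auto
    qed
    have "(1::'k) \<noteq> - 1" using two by (simp add: eq_neg_iff_add_eq_0)
    moreover note cube_root(5,8)[OF root]
    \<comment> \<open>Each of the two conditions excludes at most one \<open>t\<close>, so one of
      three distinct scalars remains. The field may be finite, hence the explicit choice.\<close>
    ultimately have "\<exists>t\<in>{1, - 1, w}. p i + t * h i \<noteq> 0 \<and> p k + t * h k \<noteq> 0"
      using uniq[OF p(2)] uniq[OF p(3)] by (metis insertCI)
    then obtain t where t: "t \<in> {1, - 1, w}" "p i + t * h i \<noteq> 0" "p k + t * h k \<noteq> 0"
      by blast
    then have "t \<noteq> 0" using cube_root(6)[OF root] by auto
    then show ?thesis
      using add[OF p(1) scale[OF fgh(5), of t]] t True fgh(6)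
      by (intro exI[of _ "\<lambda>j. p j + t * h j"] exI[of _ "\<lambda>j. p' j + t * h' j"]) simp
  qed
qed

lemma period_mod:
  assumes "R a b e d f f'"
  shows "f (j mod 3 + k) = f (j + k)" "f' (j mod 3 + k) = f' (j + k)"
proof -
  have "f (i + 3 * n) = f i \<and> f' (i + 3 * n) = f' i" for i n
  proof (induction n)
    case (Suc n)
    have "i + 3 * Suc n = i + 3 * n + 3" by simp
    then show ?case using Suc period[OF assms, of "i + 3 * n"] by (simp only:)
  qed simp
  from this[of "j mod 3 + k" "j div 3"]
  show "f (j mod 3 + k) = f (j + k)" "f' (j mod 3 + k) = f' (j + k)"
    by (simp_all add: add.assoc add.commute[of k] add.left_commute)
qed

lemma extend_signs:
  assumes "\<And>f f'. R a b e d f f' \<Longrightarrow>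
      f' 0 = sg c0 * f k \<and> f' 1 = sg c1 * f (1 + k) \<and> f' 2 = sg c2 * f (2 + k)"
    and "R a b e d f f'"
    and "c = (\<lambda>j. if j mod 3 = 0 then c0 else if j mod 3 = 1 then c1 else c2)"
  shows "f' j = sg (c j) * f (j + k)"
proof -
  have "j mod 3 = 0 \<or> j mod 3 = 1 \<or> j mod 3 = 2" by linarith
  then show ?thesis
    using assms(1)[OF assms(2)] period_mod[OF assms(2), of j k] period_mod[OF assms(2), of j 0]
    unfolding assms(3) by auto
qed

text \<open>By Fourier inversion some eigenvector is nonzero. Its values differ by cube roots of
  unity, so none of them vanishes and their cubes agree.\<close>

lemma nonzero_eigenvector:
  assumes "R 1 1 e 1 f f'" "f 0 \<noteq> 0"
  shows "\<exists>g g'. R 1 1 e 1 g g' \<and> (\<forall>j. g j \<noteq> 0) \<and> (\<forall>j. g (Suc j) ^ 3 = g j ^ 3)"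
proof -
  have "fourier 1 f \<noteq> 0 \<or> fourier w f \<noteq> 0 \<or> fourier (w\<^sup>2) f \<noteq> 0"
    using fourier_inversion[OF root, of f] assms(2) three by auto
  then obtain r where r: "r ^ 3 = 1" "fourier r f \<noteq> 0"
    using cube_root[OF root] by (metis power_one)
  have g: "R 1 1 e 1 (eigen r f) (eigen r f')" by (rule R_eigen[OF assms(1)])
  have r0: "r \<noteq> 0" using r(1) by auto
  have s: "eigen r f (Suc j) = r\<^sup>2 * eigen r f j" for j
  proof -
    have "r\<^sup>2 * eigen r f j = r\<^sup>2 * f j + r ^ 3 * f (Suc j) + r ^ 3 * r * f (Suc (Suc j))"
      by (simp add: eigen_def algebra_simps power2_eq_square power3_eq_cube)
    then show ?thesis
      using r(1) by (simp add: eigen_def period_simps[OF assms(1)] algebra_simps)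
  qed
  have "eigen r f j \<noteq> 0" for j
    by (induction j) (use r r0 s eigen_values(1)[OF assms(1) r(1)] in auto)
  moreover have "eigen r f (Suc j) ^ 3 = eigen r f j ^ 3" for j
  proof -
    have "(r\<^sup>2) ^ 3 = 1" using r(1) by (metis power_mult mult.commute power_one)
    then show ?thesis by (simp add: s power_mult_distrib)
  qed
  ultimately show ?thesis using g by blast
qed

end

text \<open>The situation after v' has been rotated according to \<open>align\<close>;
  \<open>aligned_coreI\<close> performs the reduction.\<close>

locale aligned_core = sep_core w R for w :: "'k::field" and R +
  assumes aligned: "R 1 1 1 2 f f' \<Longrightarrow> f' j = f j"
begin

text \<open>The product of two functions with the same character of order at most 2 is an invariant
  of degree 2, so it agrees at v and v', and \<open>sign_exists\<close> applies.\<close>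

lemma signs:
  assumes "a * a = 1" "b * b = 1" "e * e = 1"
  shows "\<exists>s. (\<forall>j. s (j + 3) = s j) \<and> (\<forall>f f' j. R a b e 1 f f' \<longrightarrow> f' j = sg (s j) * f j)"
proof -
  have "\<exists>b'. \<forall>x x'. (\<exists>f f'. R a b e 1 f f' \<and> x = f j \<and> x' = f' j) \<longrightarrow> x' = sg b' * x" for j
  proof (rule sign_exists)
    fix x x' y y'
    assume "\<exists>f f'. R a b e 1 f f' \<and> x = f j \<and> x' = f' j"
      "\<exists>f f'. R a b e 1 f f' \<and> y = f j \<and> y' = f' j"
    then obtain f f' g g' where fg: "R a b e 1 f f'" "R a b e 1 g g'" "x = f j" "x' = f' j" "y = g j" "y' = g' j"
      by blast
    have "R 1 1 1 (1 + 1) (\<lambda>j. f j * g j) (\<lambda>j. f' j * g' j)"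
      using mult[OF fg(1,2)] assms by simp
    then show "x * y = x' * y'" using aligned[of _ _ j] fg(3-6) one_add_one by metis
  qed
  then obtain s where s: "\<And>f f' j. R a b e 1 f f' \<Longrightarrow> f' j = sg (s j) * f j"
    by metis
  have "f' j = sg (s (j mod 3)) * f j" if "R a b e 1 f f'" for f f' j
    using s[OF that, of "j mod 3"] period_mod[OF that, of j 0] by simp
  then show ?thesis by (intro exI[of _ "\<lambda>j. s (j mod 3)"]) auto
qed

text \<open>The differences \<open>D j\<close> sum to 0, and so do their products with an
  eigenvector of the rotation, the degree being at most 4 + 2. These two relations leave only
  multiples of (1, r^2, r), so one nonzero difference makes all three nonzero. A monomial that
  changes its sign therefore does so in all three rotations.\<close>

lemma all_signs:
  assumes n: "R 1 1 1 2 n n'" and r: "r\<^sup>2 + r + 1 = 0" and nz: "fourier r n \<noteq> 0"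
    and m: "R 1 1 1 d m m'" "d \<le> 4"
    and signs: "m' 0 = sg b0 * m 0" "m' 1 = sg b1 * m 1" "m' 2 = sg b2 * m 2"
    and b0: "m 0 \<noteq> 0" "b0"
  shows "m 1 \<noteq> 0 \<and> m 2 \<noteq> 0 \<and> b1 \<and> b2"
proof -
  note cr = cube_root[OF r]
  let ?N = "eigen r n"
  define D where "D j = m j - m' j" for j
  have mN: "R 1 1 1 (d + 2) (\<lambda>j. m j * ?N j) (\<lambda>j. m' j * eigen r n' j)"
    using mult[OF m(1) R_eigen[OF n, of r]] by simp
  then have "m 0 * ?N 0 + m 1 * ?N 1 + m 2 * ?N 2 = m' 0 * ?N 0 + m' 1 * ?N 1 + m' 2 * ?N 2"
    using sum_eq_le[OF mN] m(2) by (simp add: aligned[OF R_eigen[OF n, of r]])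
  then have "fourier r n * (D 0 + r\<^sup>2 * D 1 + r * D 2) = 0"
    unfolding eigen_values[OF n cr(1)] D_def by (simp add: algebra_simps)
  then have D2: "D 0 + r\<^sup>2 * D 1 + r * D 2 = 0" using nz by simp
  have D1: "D 0 + D 1 + D 2 = 0"
    using sum_eq_le[OF m(1)] m(2) by (simp add: D_def algebra_simps)
  have D0: "D 0 \<noteq> 0"
    using b0 signs(1) two by (simp add: D_def)
  have "D 1 \<noteq> 0"
  proof
    assume z: "D 1 = 0"
    then have "D 2 = - D 0" using D1 by (simp add: eq_neg_iff_add_eq_0 add.commute)
    then have "(1 - r) * D 0 = 0" using D2 z by (simp add: algebra_simps)
    then show False using D0 cr(5) by simp
  qed
  moreover have "D 2 \<noteq> 0"
  proof
    assume z: "D 2 = 0"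
    then have "D 1 = - D 0" using D1 by (simp add: eq_neg_iff_add_eq_0 add.commute)
    then have "(1 - r\<^sup>2) * D 0 = 0" using D2 z by (simp add: algebra_simps)
    then have "r\<^sup>2 = 1" using D0 by simp
    then show False using cr(3,5) by simp
  qed
  ultimately show ?thesis
    using signs(2,3) by (auto simp: D_def sg_def split: if_splits)
qed

text \<open>\<open>nzp j\<close>, \<open>nzq j\<close> and \<open>nzy\<close> tell which points p_j,
  q_j, y of the Fano plane carry a nonzero value. The p_j are the characters trivial on the factor
  of order 2, y is the one trivial on the Klein four-group, and q_j is the product of p_j and
  y.\<close>

definition nzp :: "nat \<Rightarrow> bool"
  where "nzp j \<longleftrightarrow> (\<exists>f f'. R 1 (- 1) 1 1 f f' \<and> f j \<noteq> 0)"

definition nzq :: "nat \<Rightarrow> bool"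
  where "nzq j \<longleftrightarrow> (\<exists>f f'. R 1 (- 1) (- 1) 1 f f' \<and> f j \<noteq> 0)"

definition nzy :: bool
  where "nzy \<longleftrightarrow> (\<exists>f f'. R 1 1 (- 1) 1 f f' \<and> f 0 \<noteq> 0)"

lemma nz_period [simp]: "nzp (Suc (Suc (Suc j))) = nzp j" "nzq (Suc (Suc (Suc j))) = nzq j"
  unfolding nzp_def nzq_def by (metis period_simps(7))+

lemma shift1: "R 1 (- 1) e d f f' \<Longrightarrow> R (- 1) (- 1) e d (\<lambda>j. f (Suc j)) (\<lambda>j. f' (Suc j))"
  using shift[of 1 "- 1" e d f f'] by simp

lemma shift2: "R 1 (- 1) e d f f' \<Longrightarrow> R (- 1) 1 e d (\<lambda>j. f (Suc (Suc j))) (\<lambda>j. f' (Suc (Suc j)))"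
  using shift[OF shift1, of e d f f'] by simp

text \<open>A monomial constant under rotation contributes 3 times its value to
  \<open>sum_eq\<close>, so a change of sign would make 6 times a nonzero value vanish.\<close>

lemma constant_sign:
  assumes m: "R 1 1 1 d m m'" "d \<le> 6" and "\<And>j. m (Suc j) = m j" "m 0 \<noteq> 0"
    and "m' 0 = sg b * m 0" "m' 1 = sg b * m 1" "m' 2 = sg b * m 2"
  shows "\<not> b"
proof -
  have "m 1 = m 0" "m 2 = m 0"
    using assms(3)[of 0] assms(3)[of 1] by (simp_all add: numeral_2_eq_2)
  then have "3 * m 0 = sg b * (3 * m 0)"
    using sum_eq_le[OF m] assms(5-7) by (simp add: algebra_simps)
  then show ?thesis using three two assms(4) by (auto simp: sg_def split: if_splits)
qed

definition sign_data :: "(nat \<Rightarrow> bool) \<Rightarrow> (nat \<Rightarrow> bool) \<Rightarrow> bool \<Rightarrow> bool"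
  where "sign_data s t u \<longleftrightarrow>
    (\<forall>j. s (Suc (Suc (Suc j))) = s j) \<and> (\<forall>j. t (Suc (Suc (Suc j))) = t j) \<and>
    (\<forall>f f' j. R 1 (- 1) 1 1 f f' \<longrightarrow> f' j = sg (s j) * f j) \<and>
    (\<forall>f f' j. R 1 (- 1) (- 1) 1 f f' \<longrightarrow> f' j = sg (t j) * f j) \<and>
    (\<forall>f f' j. R 1 1 (- 1) 1 f f' \<longrightarrow> f' j = sg u * f j)"

section \<open>Signs on the lines of the Fano plane and on their complements\<close>

context
  fixes s t u
  assumes sign_data: "sign_data s t u"
begin

lemma s3: "s (Suc (Suc (Suc j))) = s j"
  and t3: "t (Suc (Suc (Suc j))) = t j"
  and s: "R 1 (- 1) 1 1 f f' \<Longrightarrow> f' j = sg (s j) * f j"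
  and t: "R 1 (- 1) (- 1) 1 f f' \<Longrightarrow> f' j = sg (t j) * f j"
  and u: "R 1 1 (- 1) 1 f f' \<Longrightarrow> f' j = sg u * f j"
  using sign_data unfolding sign_data_def by blast+


text \<open>The rotation permutes the three points of this line, so the product of the values of a
  single \<open>f\<close> is constant under rotation and has degree 3.\<close>

lemma signs_ppp:
  assumes "nzp j" "nzp (Suc j)" "nzp (Suc (Suc j))"
  shows "\<not> (s j \<noteq> (s (Suc j) \<noteq> s (Suc (Suc j))))"
proof -
  obtain f f' where f: "R 1 (- 1) 1 1 f f'" "f j \<noteq> 0" "f (Suc j) \<noteq> 0" "f (Suc (Suc j)) \<noteq> 0"
    using common_nonzero assms unfolding nzp_def by blast
  define m m' where "m i = f i * (f (Suc i) * f (Suc (Suc i)))"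
    and "m' i = f' i * (f' (Suc i) * f' (Suc (Suc i)))" for i
  have "R 1 1 1 (1 + (1 + 1)) m m'"
    using mult[OF f(1) mult[OF shift1[OF f(1)] shift2[OF f(1)]]] by (simp add: m_def[abs_def] m'_def[abs_def])
  from shift_n[OF this, of j] show ?thesis
  proof (rule constant_sign)
    show "m (Suc i + j) = m (i + j)" for i
      by (simp add: m_def period_simps[OF f(1)])
  qed (use f(2-4) in \<open>auto simp: m_def m'_def s[OF f(1)] sg_def s3 numeral_2_eq_2\<close>)
qed

text \<open>This support is rotation-invariant too, but the value at y need not be constant. Its
  cube is, and has the same sign change; the degree becomes 6.\<close>

lemma signs_qqqy:
  assumes "nzq j" "nzq (Suc j)" "nzq (Suc (Suc j))" "nzy"
  shows "\<not> (t j \<noteq> (t (Suc j) \<noteq> (t (Suc (Suc j)) \<noteq> u)))"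
proof -
  obtain f f' where f: "R 1 (- 1) (- 1) 1 f f'" "f j \<noteq> 0" "f (Suc j) \<noteq> 0" "f (Suc (Suc j)) \<noteq> 0"
    using common_nonzero assms(1-3) unfolding nzq_def by blast
  obtain y y' where y: "R 1 1 (- 1) 1 y y'" "\<And>j. y j \<noteq> 0" "\<And>j. y (Suc j) ^ 3 = y j ^ 3"
    using nonzero_eigenvector assms(4) unfolding nzy_def by blast
  define m m' where "m i = f i * (f (Suc i) * f (Suc (Suc i))) * y i ^ 3"
    and "m' i = f' i * (f' (Suc i) * f' (Suc (Suc i))) * y' i ^ 3" for i
  have "R 1 1 1 ((1 + (1 + 1)) + (1 + (1 + 1))) m m'"
    using mult[OF mult[OF f(1) mult[OF shift1[OF f(1)] shift2[OF f(1)]]] mult[OF y(1) mult[OF y(1) y(1)]]]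
    by (simp add: m_def[abs_def] m'_def[abs_def] power3_eq_cube mult.assoc)
  from shift_n[OF this, of j] show ?thesis
  proof (rule constant_sign)
    show "m (Suc i + j) = m (i + j)" for i
      by (simp add: m_def period_simps[OF f(1)] y(3))
  qed (use f(2-4) y(2) in \<open>auto simp: m_def m'_def t[OF f(1)] u[OF y(1)] sg_def t3 numeral_2_eq_2 power3_eq_cube\<close>)
qed

text \<open>Here some invariant of degree at most 2 is not constant under rotation, which is what
  \<open>all_signs\<close> needs.\<close>

context
  fixes r n n'
  assumes n: "R 1 1 1 2 n n'" and r: "r\<^sup>2 + r + 1 = 0" and nz: "fourier r n \<noteq> 0"
begin

text \<open>If one sign changed, all three rotations would change theirs. In their product each q_j
  occurs twice, so the line of the p_j would change its sign, against
  \<open>signs_ppp\<close>.\<close>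

lemma signs_pqq:
  assumes "nzp j" "nzq (Suc j)" "nzq (Suc (Suc j))"
  shows "\<not> (s j \<noteq> (t (Suc j) \<noteq> t (Suc (Suc j))))"
proof
  assume b: "s j \<noteq> (t (Suc j) \<noteq> t (Suc (Suc j)))"
  obtain f f' g g' h h' where f: "R 1 (- 1) 1 1 f f'" "f j \<noteq> 0" and g: "R 1 (- 1) (- 1) 1 g g'" "g (Suc j) \<noteq> 0"
    and h: "R 1 (- 1) (- 1) 1 h h'" "h (Suc (Suc j)) \<noteq> 0"
    using assms unfolding nzp_def nzq_def by blast
  define m m' where "m i = f i * (g (Suc i) * h (Suc (Suc i)))"
    and "m' i = f' i * (g' (Suc i) * h' (Suc (Suc i)))" for i
  have "R 1 1 1 (1 + (1 + 1)) m m'"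
    using mult[OF f(1) mult[OF shift1[OF g(1)] shift2[OF h(1)]]] by (simp add: m_def[abs_def] m'_def[abs_def])
  note m = shift_n[OF this, of j]
  have sgn: "m' i = sg (s i \<noteq> (t (Suc i) \<noteq> t (Suc (Suc i)))) * m i" for i
    by (simp add: m_def m'_def s[OF f(1)] t[OF g(1)] t[OF h(1)] sg_def)
  have *: "m (1 + j) \<noteq> 0 \<and> m (2 + j) \<noteq> 0 \<and> (s (1 + j) \<noteq> (t (Suc (1 + j)) \<noteq> t (Suc (Suc (1 + j)))))
      \<and> (s (2 + j) \<noteq> (t (Suc (2 + j)) \<noteq> t (Suc (Suc (2 + j)))))"
    by (rule all_signs[OF n r nz m _ sgn sgn sgn]) (use b f(2) g(2) h(2) in \<open>simp_all add: m_def\<close>)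
  then have "nzp (Suc j)" "nzp (Suc (Suc j))"
    unfolding nzp_def m_def using f(1) by (auto simp: numeral_2_eq_2)
  note p = signs_ppp[OF assms(1) this]
  have "s (Suc j) \<noteq> (t (Suc (Suc j)) \<noteq> t j)" "s (Suc (Suc j)) \<noteq> (t j \<noteq> t (Suc j))"
    using * by (simp_all add: numeral_2_eq_2 t3)
  with b p show False by satx
qed

text \<open>The product of the three rotations is that of the p_j times that of the q_j and y^3;
  neither factor changes its sign, by \<open>signs_ppp\<close> and
  \<open>signs_qqqy\<close>.\<close>

lemma signs_pqy:
  assumes "nzp j" "nzq j" "nzy"
  shows "\<not> (s j \<noteq> (t j \<noteq> u))"
proof
  assume b: "s j \<noteq> (t j \<noteq> u)"
  obtain f f' g g' where f: "R 1 (- 1) 1 1 f f'" "f j \<noteq> 0" and g: "R 1 (- 1) (- 1) 1 g g'" "g j \<noteq> 0"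
    using assms unfolding nzp_def nzq_def by blast
  obtain y y' where y: "R 1 1 (- 1) 1 y y'" "\<And>j. y j \<noteq> 0"
    using nonzero_eigenvector assms(3) unfolding nzy_def by blast
  define m m' where "m i = f i * (g i * y i)" and "m' i = f' i * (g' i * y' i)" for i
  have "R 1 1 1 (1 + (1 + 1)) m m'"
    using mult[OF f(1) mult[OF g(1) y(1)]] by (simp add: m_def[abs_def] m'_def[abs_def])
  note m = shift_n[OF this, of j]
  have sgn: "m' i = sg (s i \<noteq> (t i \<noteq> u)) * m i" for i
    by (simp add: m_def m'_def s[OF f(1)] t[OF g(1)] u[OF y(1)] sg_def)
  have *: "m (1 + j) \<noteq> 0 \<and> m (2 + j) \<noteq> 0 \<and> (s (1 + j) \<noteq> (t (1 + j) \<noteq> u)) \<and> (s (2 + j) \<noteq> (t (2 + j) \<noteq> u))"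
    by (rule all_signs[OF n r nz m _ sgn sgn sgn]) (use b f(2) g(2) y(2) in \<open>simp_all add: m_def\<close>)
  then have "nzp (Suc j)" "nzp (Suc (Suc j))" "nzq (Suc j)" "nzq (Suc (Suc j))"
    unfolding nzp_def nzq_def m_def using f(1) g(1) by (auto simp: numeral_2_eq_2)
  note p = signs_ppp[OF assms(1) this(1,2)] signs_qqqy[OF assms(2) this(3,4) assms(3)]
  have "s (Suc j) \<noteq> (t (Suc j) \<noteq> u)" "s (Suc (Suc j)) \<noteq> (t (Suc (Suc j)) \<noteq> u)"
    using * by (simp_all add: numeral_2_eq_2)
  with b p show False by satx
qed

text \<open>In the product of the three rotations each p_j occurs twice; the q_j and y^3 remain, and
  \<open>signs_qqqy\<close> gives the contradiction.\<close>

lemma signs_qppy: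
  assumes "nzq j" "nzp (Suc j)" "nzp (Suc (Suc j))" "nzy"
  shows "\<not> (t j \<noteq> (s (Suc j) \<noteq> (s (Suc (Suc j)) \<noteq> u)))"
proof
  assume b: "t j \<noteq> (s (Suc j) \<noteq> (s (Suc (Suc j)) \<noteq> u))"
  obtain f f' g g' h h' where f: "R 1 (- 1) (- 1) 1 f f'" "f j \<noteq> 0" and g: "R 1 (- 1) 1 1 g g'" "g (Suc j) \<noteq> 0"
    and h: "R 1 (- 1) 1 1 h h'" "h (Suc (Suc j)) \<noteq> 0"
    using assms unfolding nzp_def nzq_def by blast
  obtain y y' where y: "R 1 1 (- 1) 1 y y'" "\<And>j. y j \<noteq> 0"
    using nonzero_eigenvector assms(4) unfolding nzy_def by blast
  define m m' where "m i = f i * (g (Suc i) * h (Suc (Suc i))) * y i"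
    and "m' i = f' i * (g' (Suc i) * h' (Suc (Suc i))) * y' i" for i
  have "R 1 1 1 (1 + (1 + 1) + 1) m m'"
    using mult[OF mult[OF f(1) mult[OF shift1[OF g(1)] shift2[OF h(1)]]] y(1)]
    by (simp add: m_def[abs_def] m'_def[abs_def])
  note m = shift_n[OF this, of j]
  have sgn: "m' i = sg (t i \<noteq> (s (Suc i) \<noteq> (s (Suc (Suc i)) \<noteq> u))) * m i" for i
    by (simp add: m_def m'_def t[OF f(1)] s[OF g(1)] s[OF h(1)] u[OF y(1)] sg_def)
  have *: "m (1 + j) \<noteq> 0 \<and> m (2 + j) \<noteq> 0
      \<and> (t (1 + j) \<noteq> (s (Suc (1 + j)) \<noteq> (s (Suc (Suc (1 + j))) \<noteq> u)))
      \<and> (t (2 + j) \<noteq> (s (Suc (2 + j)) \<noteq> (s (Suc (Suc (2 + j))) \<noteq> u)))"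
    by (rule all_signs[OF n r nz m _ sgn sgn sgn]) (use b f(2) g(2) h(2) y(2) in \<open>simp_all add: m_def\<close>)
  then have "nzq (Suc j)" "nzq (Suc (Suc j))"
    unfolding nzq_def m_def using f(1) by (auto simp: numeral_2_eq_2)
  note q = signs_qqqy[OF assms(1) this assms(4)]
  have "t (Suc j) \<noteq> (s (Suc (Suc j)) \<noteq> (s j \<noteq> u))" "t (Suc (Suc j)) \<noteq> (s j \<noteq> (s (Suc j) \<noteq> u))"
    using * by (simp_all add: numeral_2_eq_2 s3)
  with b q show False by satx
qed

text \<open>In the product of the three rotations every point occurs twice, so the three signs
  cannot all change.\<close>

lemma signs_pqpq:
  assumes "nzp j" "nzq j" "nzp (Suc j)" "nzq (Suc j)"
  shows "\<not> (s j \<noteq> (t j \<noteq> (s (Suc j) \<noteq> t (Suc j))))"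
proof
  assume b: "s j \<noteq> (t j \<noteq> (s (Suc j) \<noteq> t (Suc j)))"
  obtain f f' g g' h h' k k' where f: "R 1 (- 1) 1 1 f f'" "f j \<noteq> 0" and g: "R 1 (- 1) (- 1) 1 g g'" "g j \<noteq> 0"
    and h: "R 1 (- 1) 1 1 h h'" "h (Suc j) \<noteq> 0" and k: "R 1 (- 1) (- 1) 1 k k'" "k (Suc j) \<noteq> 0"
    using assms unfolding nzp_def nzq_def by blast
  define m m' where "m i = f i * g i * (h (Suc i) * k (Suc i))"
    and "m' i = f' i * g' i * (h' (Suc i) * k' (Suc i))" for i
  have "R 1 1 1 (1 + 1 + (1 + 1)) m m'"
    using mult[OF mult[OF f(1) g(1)] mult[OF shift1[OF h(1)] shift1[OF k(1)]]]
    by (simp add: m_def[abs_def] m'_def[abs_def])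
  note m = shift_n[OF this, of j]
  have sgn: "m' i = sg (s i \<noteq> (t i \<noteq> (s (Suc i) \<noteq> t (Suc i)))) * m i" for i
    by (simp add: m_def m'_def s[OF f(1)] t[OF g(1)] s[OF h(1)] t[OF k(1)] sg_def)
  have *: "m (1 + j) \<noteq> 0 \<and> m (2 + j) \<noteq> 0
      \<and> (s (1 + j) \<noteq> (t (1 + j) \<noteq> (s (Suc (1 + j)) \<noteq> t (Suc (1 + j)))))
      \<and> (s (2 + j) \<noteq> (t (2 + j) \<noteq> (s (Suc (2 + j)) \<noteq> t (Suc (2 + j)))))"
    by (rule all_signs[OF n r nz m _ sgn sgn sgn]) (use b f(2) g(2) h(2) k(2) in \<open>simp_all add: m_def\<close>)
  have "s (Suc j) \<noteq> (t (Suc j) \<noteq> (s (Suc (Suc j)) \<noteq> t (Suc (Suc j))))"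
    "s (Suc (Suc j)) \<noteq> (t (Suc (Suc j)) \<noteq> (s j \<noteq> t j))"
    using * by (simp_all add: numeral_2_eq_2 s3 t3)
  with b show False by satx
qed

end

end

end

section \<open>Group elements in terms of signs\<close>

context sep_core
begin

text \<open>A solution encodes an element of the group carrying v to v': \<open>k\<close> is the
  power of c, \<open>a 0\<close>, \<open>a 1\<close>, \<open>a 2\<close> are the values of the three
  nontrivial characters of the Klein four-group at its Klein part (hence the product 1), and
  \<open>d\<close> tells whether the generator of the factor of order 2 occurs.\<close>

definition solution :: "nat \<Rightarrow> (nat \<Rightarrow> bool) \<Rightarrow> bool \<Rightarrow> bool"
  where "solution k a d \<longleftrightarrow> \<not> (a 0 \<noteq> (a 1 \<noteq> a 2)) \<and> (\<forall>j. a (j + 3) = a j) \<and>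
    (\<forall>f f' j. R 1 (- 1) 1 1 f f' \<longrightarrow> f' j = sg (a j) * f (j + k)) \<and>
    (\<forall>f f' j. R 1 (- 1) (- 1) 1 f f' \<longrightarrow> f' j = sg (a j \<noteq> d) * f (j + k)) \<and>
    (\<forall>f f' j. R 1 1 (- 1) 1 f f' \<longrightarrow> f' j = sg d * f (j + k)) \<and>
    (\<forall>f f' j. R 1 1 1 1 f f' \<longrightarrow> f' j = f (j + k))"

lemma solutionI:
  assumes "\<not> (a0 \<noteq> (a1 \<noteq> a2))"
    and "\<And>f f'. R 1 (- 1) 1 1 f f' \<Longrightarrow>
      f' 0 = sg a0 * f k \<and> f' 1 = sg a1 * f (1 + k) \<and> f' 2 = sg a2 * f (2 + k)"
    and "\<And>f f'. R 1 (- 1) (- 1) 1 f f' \<Longrightarrow>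
      f' 0 = sg (a0 \<noteq> d) * f k \<and> f' 1 = sg (a1 \<noteq> d) * f (1 + k) \<and> f' 2 = sg (a2 \<noteq> d) * f (2 + k)"
    and y: "\<And>f f'. R 1 1 (- 1) 1 f f' \<Longrightarrow> f' 0 = sg d * f k"
    and z: "\<And>f f'. R 1 1 1 1 f f' \<Longrightarrow> f' 0 = f k"
  shows "\<exists>a. solution k a d"
proof -
  define a where "a = (\<lambda>j::nat. if j mod 3 = 0 then a0 else if j mod 3 = 1 then a1 else a2)"
  have ad: "(\<lambda>j. a j \<noteq> d) = (\<lambda>j::nat. if j mod 3 = 0 then a0 \<noteq> d else if j mod 3 = 1 then a1 \<noteq> d else a2 \<noteq> d)"
    by (auto simp: a_def)
  have "f' j = sg (a j) * f (j + k)" if "R 1 (- 1) 1 1 f f'" for f f' j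
    by (rule extend_signs[OF assms(2) that a_def])
  moreover have "f' j = sg (a j \<noteq> d) * f (j + k)" if "R 1 (- 1) (- 1) 1 f f'" for f f' j
    by (rule extend_signs[OF assms(3) that ad])
  moreover have "f' j = sg d * f (j + k)" if "R 1 1 (- 1) 1 f f'" for f f' j
    using y[OF shift_n[OF that, of j]] by (simp add: add.commute)
  moreover have "f' j = f (j + k)" if "R 1 1 1 1 f f'" for f f' j
    using z[OF shift_n[OF that, of j]] by (simp add: add.commute)
  moreover have "\<forall>j. a (j + 3) = a j" "\<not> (a 0 \<noteq> (a 1 \<noteq> a 2))"
    using assms(1) by (simp_all add: a_def)
  ultimately show ?thesis unfolding solution_def by blast
qed

lemma flip_sign:
  fixes x :: 'k
  assumes "y = sg e * x" "(s \<noteq> e) = (a \<noteq> E)"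
  shows "sg s * y = sg a * (sg E * x)"
  using assms by (simp only: sg_mult_left)

lemma constant_values:
  assumes n: "R 1 1 1 d n n'" and "fourier w n = 0" "fourier (w\<^sup>2) n = 0"
  shows "n j = n 0"
proof -
  note cr = cube_root[OF root]
  have "(w - w\<^sup>2) * (n 1 - n 2) = fourier w n - fourier (w\<^sup>2) n"
    unfolding fourier_def cr(3) by (simp add: algebra_simps)
  also have "\<dots> = 0" using assms(2,3) by simp
  finally have "(w - w\<^sup>2) * (n 1 - n 2) = 0" .
  moreover have "w - w\<^sup>2 \<noteq> 0" using cr(7) by auto
  ultimately have 12: "n 1 = n 2" by (metis mult_eq_0_iff eq_iff_diff_eq_0)
  have "n 0 - n 1 = fourier w n - (w\<^sup>2 + w + 1) * n 1"
    unfolding fourier_def by (simp add: 12[symmetric] algebra_simps)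
  then have 01: "n 1 = n 0" using assms(2) root by simp
  have "j mod 3 = 0 \<or> j mod 3 = 1 \<or> j mod 3 = 2" by linarith
  then show ?thesis using period_mod(1)[OF n, of j 0] 01 12 by auto
qed

end

section \<open>Existence of a solution in the aligned case\<close>

context aligned_core
begin

text \<open>The argument of \<open>signs\<close>, with the values at \<open>j\<close> and at 0 in
  the place of those at v' and v.\<close>

lemma constant_case:
  assumes const_S: "\<forall>n n' j. R 1 1 1 2 n n' \<longrightarrow> n j = n 0"
    and ee: "e * e = 1"
  shows "\<exists>h. \<forall>f f' j. R 1 (- 1) e 1 f f' \<longrightarrow> f j = sg (h j) * f 0"
proof -
  have "\<exists>b. \<forall>x x'. (\<exists>f f'. R 1 (- 1) e 1 f f' \<and> x = f 0 \<and> x' = f j) \<longrightarrow> x' = sg b * x" for j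
  proof (rule sign_exists)
    fix x x' y y'
    assume "\<exists>f f'. R 1 (- 1) e 1 f f' \<and> x = f 0 \<and> x' = f j"
      "\<exists>f f'. R 1 (- 1) e 1 f f' \<and> y = f 0 \<and> y' = f j"
    then obtain f f' g g' where fg: "R 1 (- 1) e 1 f f'" "R 1 (- 1) e 1 g g'"
      "x = f 0" "x' = f j" "y = g 0" "y' = g j"
      by blast
    have "R 1 1 1 (1 + 1) (\<lambda>j. f j * g j) (\<lambda>j. f' j * g' j)"
      using mult[OF fg(1,2)] ee by simp
    then show "x * y = x' * y'" using const_S fg(3-6) one_add_one by metis
  qed
  then show ?thesis by metis
qed

lemma solution_exists: "\<exists>k a d. solution k a d"
proof -
  have mm: "(- 1 :: 'k) * - 1 = 1" by simp
  obtain s where s3: "\<And>j. s (j + 3) = s j" and s: "\<And>f f' j. R 1 (- 1) 1 1 f f' \<Longrightarrow> f' j = sg (s j) * f j"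
    using signs[OF mult_1 mm mult_1] by blast
  obtain t where t3: "\<And>j. t (j + 3) = t j" and t: "\<And>f f' j. R 1 (- 1) (- 1) 1 f f' \<Longrightarrow> f' j = sg (t j) * f j"
    using signs[OF mult_1 mm mm] by blast
  obtain v where v: "\<And>f f' j. R 1 1 (- 1) 1 f f' \<Longrightarrow> f' j = sg (v j :: bool) * f j"
    using signs[OF mult_1 mult_1 mm] by blast
  \<comment> \<open>The shift fixes the character of y, so its sign at 0 is valid for every
    \<open>j\<close>.\<close>
  define u where "u = v 0"
  have u: "f' j = sg u * f j" if "R 1 1 (- 1) 1 f f'" for f f' j
    using v[OF shift_n[OF that, of j], of 0] by (simp add: u_def)
  have s3': "s (Suc (Suc (Suc j))) = s j" and t3': "t (Suc (Suc (Suc j))) = t j" for j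
    using s3[of j] t3[of j] by (simp_all add: numeral_3_eq_3)
  have z: "f' 0 = f 0" if "R 1 1 1 1 f f'" for f f'
    using aligned[OF mono[OF that], of 0] by simp
  have sd: "sign_data s t u"
    unfolding sign_data_def using s3' t3' s t u by blast
  note F1 = signs_ppp[OF sd, of 0] and F2 = signs_qqqy[OF sd, of 0]
  \<comment> \<open>These are the dependencies with a support that is not rotation-invariant;
    \<open>F1\<close> and \<open>F2\<close> are the other two.\<close>
  define circuits where "circuits \<longleftrightarrow> (\<forall>j.
      (nzp j \<and> nzq (Suc j) \<and> nzq (Suc (Suc j)) \<longrightarrow> \<not> (s j \<noteq> (t (Suc j) \<noteq> t (Suc (Suc j))))) \<and>
      (nzp j \<and> nzq j \<and> nzy \<longrightarrow> \<not> (s j \<noteq> (t j \<noteq> u))) \<and>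
      (nzq j \<and> nzp (Suc j) \<and> nzp (Suc (Suc j)) \<and> nzy \<longrightarrow> \<not> (t j \<noteq> (s (Suc j) \<noteq> (s (Suc (Suc j)) \<noteq> u)))) \<and>
      (nzp j \<and> nzq j \<and> nzp (Suc j) \<and> nzq (Suc j) \<longrightarrow> \<not> (s j \<noteq> (t j \<noteq> (s (Suc j) \<noteq> t (Suc j))))))"
  have main: "\<exists>k a d. solution k a d" if c: "circuits"
  proof -
    note circ = spec[OF c[unfolded circuits_def]]
    have "\<exists>a0 a1 a2 d. \<not> (a0 \<noteq> (a1 \<noteq> a2))
        \<and> (nzp 0 \<longrightarrow> s 0 = a0) \<and> (nzp 1 \<longrightarrow> s 1 = a1) \<and> (nzp 2 \<longrightarrow> s 2 = a2)
        \<and> (nzq 0 \<longrightarrow> t 0 = (a0 \<noteq> d)) \<and> (nzq 1 \<longrightarrow> t 1 = (a1 \<noteq> d)) \<and> (nzq 2 \<longrightarrow> t 2 = (a2 \<noteq> d))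
        \<and> (nzy \<longrightarrow> u = d)"
      by (rule fano_signs; use F1 F2 circ[of 0] circ[of 1] circ[of "Suc (Suc 0)"] in
          \<open>(simp only: numeral_2_eq_2 s3' t3' nz_period One_nat_def; satx)\<close>)
    then obtain a0 a1 a2 d where a: "\<not> (a0 \<noteq> (a1 \<noteq> a2))"
      "nzp 0 \<longrightarrow> s 0 = a0" "nzp 1 \<longrightarrow> s 1 = a1" "nzp 2 \<longrightarrow> s 2 = a2"
      "nzq 0 \<longrightarrow> t 0 = (a0 \<noteq> d)" "nzq 1 \<longrightarrow> t 1 = (a1 \<noteq> d)" "nzq 2 \<longrightarrow> t 2 = (a2 \<noteq> d)"
      "nzy \<longrightarrow> u = d"
      by (elim exE conjE) (rule that; assumption)
    have "\<exists>a. solution 0 a d"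
    proof (rule solutionI[OF a(1)])
      fix f f' assume f: "R 1 (- 1) 1 1 f f'"
      \<comment> \<open>A point without nonzero values admits either sign.\<close>
      have *: "sg (s j) * f j = sg b * f j" if "nzp j \<longrightarrow> s j = b" for b j
        using that f unfolding nzp_def by (cases "f j = 0") auto
      show "f' 0 = sg a0 * f 0 \<and> f' 1 = sg a1 * f (1 + 0) \<and> f' 2 = sg a2 * f (2 + 0)"
        unfolding s[OF f] add_0_right using a(2-4) by (intro conjI *)
    next
      fix f f' assume f: "R 1 (- 1) (- 1) 1 f f'"
      have *: "sg (t j) * f j = sg b * f j" if "nzq j \<longrightarrow> t j = b" for b j
        using that f unfolding nzq_def by (cases "f j = 0") auto
      show "f' 0 = sg (a0 \<noteq> d) * f 0 \<and> f' 1 = sg (a1 \<noteq> d) * f (1 + 0) \<and> f' 2 = sg (a2 \<noteq> d) * f (2 + 0)"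
        unfolding t[OF f] add_0_right using a(5-7) by (intro conjI *)
    next
      fix f f' assume f: "R 1 1 (- 1) 1 f f'"
      show "f' 0 = sg d * f 0"
        unfolding u[OF f] using a(8) f unfolding nzy_def by (cases "f 0 = 0") auto
    qed (use z in auto)
    then show ?thesis by blast
  qed
  show ?thesis
  proof (cases "\<exists>r n n'. R 1 1 1 2 n n' \<and> r\<^sup>2 + r + 1 = 0 \<and> fourier r n \<noteq> 0")
    case True
    then obtain r n n' where n: "R 1 1 1 2 n n'" and r: "r\<^sup>2 + r + 1 = 0" and nz: "fourier r n \<noteq> 0" by blast
    show ?thesis
      by (rule main)
        (use signs_pqq[OF sd n r nz] signs_pqy[OF sd n r nz] signs_qppy[OF sd n r nz]
          signs_pqpq[OF sd n r nz] in \<open>simp add: circuits_def\<close>)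
  next
    case False
    then have const_S: "n j = n 0" if "R 1 1 1 2 n n'" for n n' j
      using constant_values[OF that] that root cube_root(2)[OF root] by blast
    have const_S': "\<forall>n n' j. R 1 1 1 2 n n' \<longrightarrow> n j = n 0"
      using const_S by blast
    obtain e where e: "\<And>f f' j. R 1 (- 1) 1 1 f f' \<Longrightarrow> f j = sg (e j) * f 0"
      using constant_case[OF const_S' mult_1] by blast
    obtain h where h: "\<And>f f' j. R 1 (- 1) (- 1) 1 f f' \<Longrightarrow> f j = sg (h j) * f 0"
      using constant_case[OF const_S' mm] by blast
    show ?thesis
    proof (cases "nzp 0 \<and> nzq 0")
      case False
      \<comment> \<open>Values of one character differ only by signs along a rotation, so all p_j or
        all q_j carry only zeros. Every clause of \<open>circuits\<close> involves some p_j and some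
        q_j, so all of them hold vacuously.\<close>
      have "nzp j \<Longrightarrow> nzp 0" "nzq j \<Longrightarrow> nzq 0" for j
        unfolding nzp_def nzq_def by (metis e mult_zero_right) (metis h mult_zero_right)
      then show ?thesis
        using False by (intro main) (auto simp: circuits_def)
    next
      case True
      then obtain f f' g g' where f: "R 1 (- 1) 1 1 f f'" "f 0 \<noteq> 0" and g: "R 1 (- 1) (- 1) 1 g g'" "g 0 \<noteq> 0"
        unfolding nzp_def nzq_def by blast
      have e0: "\<not> e 0" using e[OF f(1), of 0] f(2) two by (auto simp: sg_def split: if_splits)
      have h0: "\<not> h 0" using h[OF g(1), of 0] g(2) two by (auto simp: sg_def split: if_splits)
      have p: "nzp j" for j
        using e[OF f(1), of j] f unfolding nzp_def by (intro exI[of _ f] exI[of _ f']) simp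
      have q: "nzq j" for j
        using h[OF g(1), of j] g unfolding nzq_def by (intro exI[of _ g] exI[of _ g']) simp
      \<comment> \<open>The monomials p_i q_(i+1) q_(i+2) have the values \<open>x\<close> times the
        sign A_i at v and \<open>x\<close> times the sign B_i at v'.\<close>
      define A0 A1 A2 where "A0 \<longleftrightarrow> e 0 \<noteq> (h 1 \<noteq> h 2)" "A1 \<longleftrightarrow> e 1 \<noteq> (h 2 \<noteq> h 0)" "A2 \<longleftrightarrow> e 2 \<noteq> (h 0 \<noteq> h 1)"
      define B0 B1 B2 where "B0 \<longleftrightarrow> s 0 \<noteq> (t 1 \<noteq> (t 2 \<noteq> A0))" "B1 \<longleftrightarrow> s 1 \<noteq> (t 2 \<noteq> (t 0 \<noteq> A1))"
        "B2 \<longleftrightarrow> s 2 \<noteq> (t 0 \<noteq> (t 1 \<noteq> A2))"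
      define d where "d \<longleftrightarrow> t 0 \<noteq> (t 1 \<noteq> t 2)"
      define x where "x = f 0 * (g 0 * g 0)"
      have S: "R 1 1 1 (1 + (1 + 1)) (\<lambda>j. f j * (g (Suc j) * g (Suc (Suc j))))
          (\<lambda>j. f' j * (g' (Suc j) * g' (Suc (Suc j))))"
        using mult[OF f(1) mult[OF shift1[OF g(1)] shift2[OF g(1)]]] by simp
      have l: "f 0 * (g 1 * g 2) = sg A0 * x" "f 1 * (g 2 * g 0) = sg A1 * x" "f 2 * (g 0 * g 1) = sg A2 * x"
        using e0 h0 unfolding e[OF f(1), of 1] e[OF f(1), of 2] h[OF g(1), of 1] h[OF g(1), of 2]
        by (simp_all add: sg_def x_def A0_A1_A2_def)
      have r: "f' 0 * (g' 1 * g' 2) = sg B0 * x" "f' 1 * (g' 2 * g' 0) = sg B1 * x" "f' 2 * (g' 0 * g' 1) = sg B2 * x"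
      proof -
        have "f' 0 * (g' 1 * g' 2) = sg (s 0) * (sg (t 1) * (sg (t 2) * (f 0 * (g 1 * g 2))))"
          "f' 1 * (g' 2 * g' 0) = sg (s 1) * (sg (t 2) * (sg (t 0) * (f 1 * (g 2 * g 0))))"
          "f' 2 * (g' 0 * g' 1) = sg (s 2) * (sg (t 0) * (sg (t 1) * (f 2 * (g 0 * g 1))))"
          unfolding s[OF f(1)] t[OF g(1)] by (simp_all only: ac_simps)
        then show "f' 0 * (g' 1 * g' 2) = sg B0 * x" "f' 1 * (g' 2 * g' 0) = sg B1 * x" "f' 2 * (g' 0 * g' 1) = sg B2 * x"
          unfolding l by (simp_all add: sg_def B0_B1_B2_def)
      qed
      have "(sg A0 + sg A1 + sg A2) * x = (sg B0 + sg B1 + sg B2) * x"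
        using sum_eq_le[OF S] l r
        by (simp add: numeral_2_eq_2 period_simps[OF g(1)] distrib_right)
      then have "sg A0 + sg A1 + sg A2 = (sg B0 + sg B1 + sg B2 :: 'k)"
        using f(2) g(2) by (simp add: x_def)
      note AB = sum_sg_eq[OF two three this, THEN conjunct1] sum_sg_eq[OF two three this, THEN conjunct2, THEN conjunct1]
        sum_sg_eq[OF two three this, THEN conjunct2, THEN conjunct2]
      have s012: "\<not> (s 0 \<noteq> (s 1 \<noteq> s 2))"
        using F1 p by (simp add: numeral_2_eq_2)
      have yd: "nzy \<Longrightarrow> d = u"
        using F2 q unfolding d_def by (auto simp: numeral_2_eq_2)
      \<comment> \<open>The products \<open>f (i + j) * f i\<close> are invariants of degree 2,
        hence constant in \<open>i\<close>. This excludes both a sign and a cube root of unity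
        between neighbouring values.\<close>
      have const_Y1: "f 1 = f 0" if f: "R 1 1 (- 1) 1 f f'" for f f'
      proof (cases "f 0 = 0")
        have "R 1 1 1 2 (\<lambda>i. f (i + j) * f i) (\<lambda>i. f' (i + j) * f' i)" for j
          using mult[OF shift_n[OF f, of j] f, unfolded one_add_one] by simp
        from const_S[OF this] have *: "f (i + j) * f i = f j * f 0" for i j by simp
        {
          case True
          then show ?thesis using *[of 1 0] by simp
        next
          case False
          have "f 2 * f 1 = f 1 * f 0" "f 1 * f 1 = f 0 * f 0" "f 0 * f 2 = f 1 * f 0"
            using *[of 1 1] *[of 1 0] *[of 2 1] period_simps[OF f]
            by (simp_all add: mult.commute numeral_2_eq_2)
          then show ?thesis using False by (metis mult.commute mult_cancel_left)
        }
      qed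
      have const_Y: "f j = f 0" if f: "R 1 1 (- 1) 1 f f'" for f f' j
        by (induction j) (use const_Y1[OF shift_n[OF f]] in \<open>simp_all add: add.commute\<close>)
      have fin: "\<exists>a. solution k a d"
        if a: "\<not> (a0 \<noteq> (a1 \<noteq> a2))"
          "(s 0 \<noteq> e 0) = (a0 \<noteq> E0)" "(s 1 \<noteq> e 1) = (a1 \<noteq> E1)" "(s 2 \<noteq> e 2) = (a2 \<noteq> E2)"
          "(t 0 \<noteq> h 0) = (d \<noteq> (a0 \<noteq> H0))" "(t 1 \<noteq> h 1) = (d \<noteq> (a1 \<noteq> H1))" "(t 2 \<noteq> h 2) = (d \<noteq> (a2 \<noteq> H2))"
        and E: "\<And>f f'. R 1 (- 1) 1 1 f f' \<Longrightarrow>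
            f k = sg E0 * f 0 \<and> f (1 + k) = sg E1 * f 0 \<and> f (2 + k) = sg E2 * f 0"
        and H: "\<And>f f'. R 1 (- 1) (- 1) 1 f f' \<Longrightarrow>
            f k = sg H0 * f 0 \<and> f (1 + k) = sg H1 * f 0 \<and> f (2 + k) = sg H2 * f 0"
        for k a0 a1 a2 E0 E1 E2 H0 H1 H2
      proof (rule solutionI[OF a(1)])
        fix f f' assume f: "R 1 (- 1) 1 1 f f'"
        show "f' 0 = sg a0 * f k \<and> f' 1 = sg a1 * f (1 + k) \<and> f' 2 = sg a2 * f (2 + k)"
          using E[OF f] by (simp only: s[OF f] flip_sign[OF e[OF f] a(2)] flip_sign[OF e[OF f] a(3)]
              flip_sign[OF e[OF f] a(4)])
      next
        fix f f' assume f: "R 1 (- 1) (- 1) 1 f f'"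
        have *: "(t 0 \<noteq> h 0) = ((a0 \<noteq> d) \<noteq> H0)" "(t 1 \<noteq> h 1) = ((a1 \<noteq> d) \<noteq> H1)" "(t 2 \<noteq> h 2) = ((a2 \<noteq> d) \<noteq> H2)"
          using a(5-7) by satx+
        show "f' 0 = sg (a0 \<noteq> d) * f k \<and> f' 1 = sg (a1 \<noteq> d) * f (1 + k) \<and> f' 2 = sg (a2 \<noteq> d) * f (2 + k)"
          using H[OF f] by (simp only: t[OF f] flip_sign[OF h[OF f] *(1)] flip_sign[OF h[OF f] *(2)]
              flip_sign[OF h[OF f] *(3)])
      next
        fix f f' assume f: "R 1 1 (- 1) 1 f f'"
        show "f' 0 = sg d * f k"
          unfolding u[OF f] const_Y[OF f, of k] using yd f unfolding nzy_def by (cases "f 0 = 0") auto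
      next
        fix f f' assume f: "R 1 1 1 1 f f'"
        show "f' 0 = f k"
          using z[OF f] const_S[OF mono[OF f], of k] by simp
      qed
      have E: "f 0 = sg (e 0) * f 0" "f (1 + 0) = sg (e 1) * f 0" "f (2 + 0) = sg (e 2) * f 0"
          "f 1 = sg (e 1) * f 0" "f (1 + 1) = sg (e 2) * f 0" "f (2 + 1) = sg (e 0) * f 0"
          "f 2 = sg (e 2) * f 0" "f (1 + 2) = sg (e 0) * f 0" "f (2 + 2) = sg (e 1) * f 0"
        if f: "R 1 (- 1) 1 1 f f'" for f f'
        using e[OF f, of 1] e[OF f, of 2] period_simps(1,2)[OF f] e0 by (simp_all add: numeral_2_eq_2 period_simps(7)[OF f])
      have H: "f 0 = sg (h 0) * f 0" "f (1 + 0) = sg (h 1) * f 0" "f (2 + 0) = sg (h 2) * f 0"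
          "f 1 = sg (h 1) * f 0" "f (1 + 1) = sg (h 2) * f 0" "f (2 + 1) = sg (h 0) * f 0"
          "f 2 = sg (h 2) * f 0" "f (1 + 2) = sg (h 0) * f 0" "f (2 + 2) = sg (h 1) * f 0"
        if f: "R 1 (- 1) (- 1) 1 f f'" for f f'
        using h[OF f, of 1] h[OF f, of 2] period_simps(1,2)[OF f] h0 by (simp_all add: numeral_2_eq_2 period_simps(7)[OF f])
      note rot = rotate_signs[OF s012 e0 h0 A0_A1_A2_def B0_B1_B2_def AB d_def]
      show ?thesis
        using rot
      \<comment> \<open>The cases are the rotations by 0, 1 and 2.\<close>
      proof (elim disjE exE conjE, goal_cases)
        case (1 a0 a1 a2)
        have "\<exists>a. solution 0 a d" by (rule fin[OF 1]) (intro conjI E H; assumption)+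
        then show ?case by blast
      next
        case (2 a0 a1 a2)
        have "\<exists>a. solution 1 a d" by (rule fin[OF 2]) (intro conjI E H; assumption)+
        then show ?case by blast
      next
        case (3 a0 a1 a2)
        have "\<exists>a. solution 2 a d" by (rule fin[OF 3]) (intro conjI E H; assumption)+
        then show ?case by blast
      qed
    qed
  qed
qed

end

section \<open>Reduction to the aligned case\<close>

context sep_core
begin

text \<open>A shift by \<open>2 * m\<close> undoes one by \<open>m\<close> modulo 3. The sum over a
  full period does not change, so \<open>sum_eq\<close> survives the replacement.\<close>

lemma aligned_coreI:
  assumes "\<And>f f' j. R 1 1 1 2 f f' \<Longrightarrow> f' j = f (j + m)"
  shows "aligned_core w (\<lambda>a b e d f g. \<exists>f'. R a b e d f f' \<and> g = (\<lambda>j. f' (j + 2 * m)))"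
proof (unfold_locales, goal_cases)
  case 4
  show ?case using const by blast
next
  case (5 a b e d f f' g g')
  then show ?case using add by fastforce
next
  case (6 a b e d f f' a2 b2 e2 d2 g g')
  then show ?case using mult by fastforce
next
  case (7 a b e d f f')
  then show ?case using shift by fastforce
next
  case (8 a b e d f f' j)
  then obtain h where h: "R a b e d f h" "f' = (\<lambda>j. h (j + 2 * m))" by blast
  show ?case
    using period[OF h(1), of j] period[OF h(1), of "j + 2 * m"] by (simp add: h(2) ac_simps)
next
  case (9 f f')
  then obtain h where h: "R 1 1 1 6 f h" "f' = (\<lambda>j. h (j + 2 * m))" by blast
  have "m mod 3 = 0 \<or> m mod 3 = 1 \<or> m mod 3 = 2" by linarith
  then have "(2 * m) mod 3 = 0 \<or> (2 * m) mod 3 = 1 \<or> (2 * m) mod 3 = 2" by linarith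
  then have "h (0 + 2 * m) + h (1 + 2 * m) + h (2 + 2 * m) = h 0 + h 1 + h 2"
    using period_mod(2)[OF h(1), of "2 * m" 0] period_mod(2)[OF h(1), of "2 * m" 1]
      period_mod(2)[OF h(1), of "2 * m" 2] period_simps[OF h(1)]
    by (auto simp: add.commute numeral_2_eq_2)
  then show ?case using sum_eq[OF h(1)] by (simp add: h(2))
next
  case (10 f f' j)
  then obtain h where h: "R 1 1 1 2 f h" "f' = (\<lambda>j. h (j + 2 * m))" by blast
  have "f (j + 2 * m + m) = f (j + 3 * m)" by (simp add: ac_simps)
  also have "\<dots> = f j"
    using period_mod(1)[OF h(1), of "3 * m" j] by (simp add: add.commute)
  finally show ?case
    using assms[OF h(1)] by (simp add: h(2))
qed (rule two three root)+

theorem core_solution: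
  "\<exists>k a d. solution k a d"
proof -
  obtain m where m: "\<And>f f' j. R 1 1 1 2 f f' \<Longrightarrow> f' j = f (j + m)" using align by blast
  interpret al: aligned_core w "\<lambda>a b e d f g. \<exists>f'. R a b e d f f' \<and> g = (\<lambda>j. f' (j + 2 * m))"
    by (rule aligned_coreI) (rule m)
  obtain k a d where sol: "al.solution k a d" using al.solution_exists by blast
  have unshift: "f' j = c (j + m) * f (j + (m + k))"
    if f: "R a b e d f f'" and "\<And>j. f' (j + 2 * m) = c j * f (j + k)" for a b e d f f' c j
  proof -
    have "f' j = f' (j + m + 2 * m)"
      using period_mod(2)[OF f, of "3 * m" j] by (simp add: ac_simps)
    then show ?thesis using that(2)[of "j + m"] by (simp add: ac_simps)
  qed
  have a3: "a (j + 3) = a j" for j using sol unfolding al.solution_def by blast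
  \<comment> \<open>Three consecutive signs form a full period, so their product does not depend on
    \<open>m\<close>.\<close>
  have "\<not> (a m \<noteq> (a (1 + m) \<noteq> a (2 + m)))"
  proof (induction m)
    case 0
    then show ?case using sol unfolding al.solution_def by simp
  next
    case (Suc m)
    then show ?case using a3[of m] by (simp add: numeral_eq_Suc) satx
  qed
  moreover have "a (j + 3 + m) = a (j + m)" for j using a3[of "j + m"] by (simp add: ac_simps)
  moreover have "f' j = sg (a (j + m)) * f (j + (m + k))" if "R 1 (- 1) 1 1 f f'" for f f' j
    by (rule unshift[OF that]) (use that sol[unfolded al.solution_def] in blast)
  moreover have "f' j = sg (a (j + m) \<noteq> d) * f (j + (m + k))" if "R 1 (- 1) (- 1) 1 f f'" for f f' j
    by (rule unshift[OF that]) (use that sol[unfolded al.solution_def] in blast)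
  moreover have "f' j = sg d * f (j + (m + k))" if "R 1 1 (- 1) 1 f f'" for f f' j
    by (rule unshift[OF that]) (use that sol[unfolded al.solution_def] in blast)
  moreover have "f' j = 1 * f (j + (m + k))" if "R 1 1 1 1 f f'" for f f' j
    by (rule unshift[OF that, where c = "\<lambda>_. 1"], unfold mult_1) (use that sol[unfolded al.solution_def] in blast)
  ultimately have "solution (m + k) (\<lambda>j. a (j + m)) d"
    unfolding solution_def by simp
  then show ?thesis by blast
qed

corollary core_characters:
  "\<exists>k p q l. \<forall>a b e f f'. a \<in> {1, - 1} \<longrightarrow> b \<in> {1, - 1} \<longrightarrow> e \<in> {1, - 1} \<longrightarrow>
    R a b e 1 f f' \<longrightarrow> f' 0 = a ^ p * b ^ q * e ^ l * f k"
proof -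
  obtain k s d where sol: "solution k s d" using core_solution by blast
  have s: "s 1 = (s 0 \<noteq> s 2)" using sol unfolding solution_def by satx
  have P: "f' j = sg (s j) * f (j + k)" if "R 1 (- 1) 1 1 f f'" for f f' j
    using sol that unfolding solution_def by blast
  have Q: "f' j = sg (s j \<noteq> d) * f (j + k)" if "R 1 (- 1) (- 1) 1 f f'" for f f' j
    using sol that unfolding solution_def by blast
  have Y: "f' j = sg d * f (j + k)" if "R 1 1 (- 1) 1 f f'" for f f' j
    using sol that unfolding solution_def by blast
  have Z: "f' j = f (j + k)" if "R 1 1 1 1 f f'" for f f' j
    using sol that unfolding solution_def by blast
  have PQ: "f' j = sg (s j) * e ^ of_bool d * f (j + k)"
    if "R 1 (- 1) e 1 f f'" "e \<in> {1, - 1}" for e f f' j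
    using that P[of f f' j] Q[of f f' j] by (auto simp: sg_def)
  have YZ: "f' j = e ^ of_bool d * f (j + k)" if "R 1 1 e 1 f f'" "e \<in> {1, - 1}" for e f f' j
    using that Y[of f f' j] Z[of f f' j] by (auto simp: sg_def)
  \<comment> \<open>The character with \<open>a = 1\<close>, \<open>b = - 1\<close> is the one at
    position 0 and that with \<open>a = - 1\<close>, \<open>b = 1\<close> the one at position 2, so
    \<open>s 0\<close> and \<open>s 2\<close> give the exponents of \<open>b\<close> and
    \<open>a\<close>. Position 1 is their product.\<close>
  have "f' 0 = a ^ of_bool (s 2) * b ^ of_bool (s 0) * e ^ of_bool d * f k"
    if f: "R a b e 1 f f'" and a: "a \<in> {1, - 1}" and b: "b \<in> {1, - 1}" and e: "e \<in> {1, - 1}"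
    for a b e f f'
  proof -
    have f3: "f' (Suc (Suc (Suc 0))) = f' 0" "f (Suc (Suc (Suc k))) = f k"
      by (rule period_simps[OF f])+
    consider "a = 1" "b = 1" | "a = 1" "b = - 1" | "a = - 1" "b = - 1" | "a = - 1" "b = 1"
      using a b by blast
    then show ?thesis
    proof cases
      case 1
      then show ?thesis using YZ[of e f f' 0] f e by simp
    next
      case 2
      then show ?thesis using PQ[of e f f' 0] f e by (simp add: sg_def)
    next
      case 3
      have "R 1 (- 1) e 1 (\<lambda>j. f (Suc (Suc j))) (\<lambda>j. f' (Suc (Suc j)))"
        using shift[OF shift[OF f]] 3 by simp
      from PQ[OF this e, of 1] show ?thesis
        using 3 s f3 by (auto simp: sg_def)
    next
      case 4
      have "R 1 (- 1) e 1 (\<lambda>j. f (Suc j)) (\<lambda>j. f' (Suc j))"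
        using shift[OF f] 4 by simp
      from PQ[OF this e, of 2] show ?thesis
        using 4 f3 by (auto simp: sg_def numeral_2_eq_2)
    qed
  qed
  then show ?thesis by blast
qed

end

section \<open>Semi-invariant functions on the group\<close>

text \<open>\<open>r1\<close> and \<open>r2\<close> generate the Klein four-group, \<open>z\<close>
  the central factor of order 2, and \<open>c\<close> has order 3. The clause \<open>enum\<close>
  states that the normal form is unique.\<close>

locale a4_times_c2 = group G for G (structure) +
  fixes r1 r2 z c
  assumes closed [simp]: "r1 \<in> carrier G" "r2 \<in> carrier G" "z \<in> carrier G" "c \<in> carrier G"
    and square: "r1 \<otimes> r1 = \<one>" "r2 \<otimes> r2 = \<one>" "z \<otimes> z = \<one>" and cube: "c \<otimes> (c \<otimes> c) = \<one>"
    and commute: "r2 \<otimes> r1 = r1 \<otimes> r2" and central: "x \<in> carrier G \<Longrightarrow> x \<otimes> z = z \<otimes> x"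
    and conj: "c \<otimes> r1 = r2 \<otimes> c" "c \<otimes> r2 = r1 \<otimes> r2 \<otimes> c"
    and enum: "bij_betw (\<lambda>(i::nat, j::nat, l::nat, k::nat). r1 [^] i \<otimes> (r2 [^] j \<otimes> (z [^] l \<otimes> c [^] k)))
      ({..<2} \<times> {..<2} \<times> {..<2} \<times> {..<3}) (carrier G)"
begin

lemma left_assoc:
  assumes "x \<otimes> y = u" "x \<in> carrier G" "y \<in> carrier G" "g \<in> carrier G"
  shows "x \<otimes> (y \<otimes> g) = u \<otimes> g"
  using assms m_assoc by metis

definition eig :: "'a \<Rightarrow> 'k::field \<Rightarrow> ('a \<Rightarrow> 'k) \<Rightarrow> bool"
  where "eig r a f \<longleftrightarrow> (\<forall>g\<in>carrier G. f (r \<otimes> g) = a * f g)"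

lemma eig_pow:
  assumes "eig r a f" "r \<in> carrier G" "g \<in> carrier G"
  shows "f (r [^] (n::nat) \<otimes> g) = a ^ n * f g"
proof (induction n)
  case (Suc n)
  have "r [^] Suc n \<otimes> g = r \<otimes> (r [^] n \<otimes> g)"
    using assms(2,3) by (simp only: nat_pow_Suc2 m_assoc nat_pow_closed)
  then show ?case using assms Suc by (simp add: eig_def)
qed (use assms in simp)

lemma eig_add: "eig r a f \<Longrightarrow> eig r a g \<Longrightarrow> eig r a (\<lambda>x. f x + g x)"
  by (simp add: eig_def distrib_left)

lemma eig_mult: "eig r a f \<Longrightarrow> eig r b g \<Longrightarrow> eig r (a * b) (\<lambda>x. f x * g x)"
  by (simp add: eig_def)

text \<open>Twice the projection onto the eigenspace; the projections for \<open>a = 1\<close> and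
  \<open>a = - 1\<close> add up to \<open>2 * f g\<close>.\<close>

lemma eig_project:
  assumes "r \<in> carrier G" "r \<otimes> r = \<one>" "a * a = 1"
  shows "eig r a (\<lambda>g. f g + a * f (r \<otimes> g))"
  unfolding eig_def
proof
  fix g assume "g \<in> carrier G"
  then have "r \<otimes> (r \<otimes> g) = g" using assms left_assoc[of r r \<one> g] by simp
  then show "f (r \<otimes> g) + a * f (r \<otimes> (r \<otimes> g)) = a * (f g + a * f (r \<otimes> g))"
    using assms(3) by (simp add: distrib_left mult.assoc[symmetric])
qed

lemma eig_project_commute:
  assumes "eig s b f" "s \<in> carrier G" "r \<in> carrier G" "r \<otimes> s = s \<otimes> r"
  shows "eig s b (\<lambda>g. f g + a * f (r \<otimes> g))"
  unfolding eig_def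
proof
  fix g assume g: "g \<in> carrier G"
  have "r \<otimes> (s \<otimes> g) = s \<otimes> (r \<otimes> g)" using g assms(2-4) m_assoc by metis
  then show "f (s \<otimes> g) + a * f (r \<otimes> (s \<otimes> g)) = b * (f g + a * f (r \<otimes> g))"
    using assms(1-3) g by (simp add: eig_def distrib_left)
qed

definition weight :: "'k::field \<Rightarrow> 'k \<Rightarrow> 'k \<Rightarrow> ('a \<Rightarrow> 'k) \<Rightarrow> bool"
  where "weight a b e f \<longleftrightarrow> eig r1 a f \<and> eig r2 b f \<and> eig z e f"

text \<open>Moving \<open>c\<close> past \<open>r1\<close> and \<open>r2\<close> by
  \<open>conj\<close> produces the cyclic change of characters assumed in
  \<open>sep_core\<close>.\<close>

lemma weight_shift:
  assumes "weight a b e f"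
  shows "weight b (a * b) e (\<lambda>g. f (c \<otimes> g))"
proof -
  have "f (c \<otimes> (r1 \<otimes> g)) = b * f (c \<otimes> g)" "f (c \<otimes> (r2 \<otimes> g)) = a * b * f (c \<otimes> g)"
    "f (c \<otimes> (z \<otimes> g)) = e * f (c \<otimes> g)" if g: "g \<in> carrier G" for g
    using assms g left_assoc[OF conj(1) _ _ g] left_assoc[OF conj(2) _ _ g]
      left_assoc[OF central[of c] _ _ g]
    by (simp_all add: weight_def eig_def m_assoc mult.assoc)
  then show ?thesis by (simp add: weight_def eig_def)
qed

lemma weight_eval:
  assumes "weight a b e f" "g \<in> carrier G"
  shows "f (r1 [^] (i::nat) \<otimes> (r2 [^] (j::nat) \<otimes> (z [^] (l::nat) \<otimes> g))) = a ^ i * b ^ j * e ^ l * f g"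
proof -
  note w = assms(1)[unfolded weight_def]
  have "f (r1 [^] i \<otimes> (r2 [^] j \<otimes> (z [^] l \<otimes> g))) = a ^ i * f (r2 [^] j \<otimes> (z [^] l \<otimes> g))"
    by (rule eig_pow) (use w assms(2) in auto)
  also have "f (r2 [^] j \<otimes> (z [^] l \<otimes> g)) = b ^ j * f (z [^] l \<otimes> g)"
    by (rule eig_pow) (use w assms(2) in auto)
  also have "f (z [^] l \<otimes> g) = e ^ l * f g"
    by (rule eig_pow) (use w assms(2) in auto)
  finally show ?thesis by (simp only: mult.assoc)
qed

lemma weight_sum:
  fixes f :: "'a \<Rightarrow> 'k::field"
  assumes "weight 1 1 1 f"
  shows "(\<Sum>g\<in>carrier G. f g) = 8 * (\<Sum>k<(3::nat). f (c [^] k))"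
proof -
  have "(\<Sum>g\<in>carrier G. f g) =
      (\<Sum>(i, j, l, k)\<in>{..<2} \<times> {..<2} \<times> {..<2} \<times> {..<3::nat}. f (r1 [^] (i::nat) \<otimes> (r2 [^] (j::nat) \<otimes> (z [^] (l::nat) \<otimes> c [^] k))))"
    unfolding sum.reindex_bij_betw[OF enum, symmetric] by (simp add: case_prod_unfold)
  also have "\<dots> = (\<Sum>(i::nat, j::nat, l::nat, k)\<in>{..<2} \<times> {..<2} \<times> {..<2} \<times> {..<3::nat}. f (c [^] k))"
    by (rule sum.cong) (use weight_eval[OF assms] in auto)
  also have "\<dots> = 8 * (\<Sum>k<(3::nat). f (c [^] k))"
    by (simp add: sum.cartesian_product[symmetric])
  finally show ?thesis .
qed

end

text \<open>\<open>T d f f'\<close> abstracts from pairs g -> p(g v), g -> p(g v') with p of degree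
  at most \<open>d\<close>. \<open>T_sum\<close> is the agreement of v and v' on invariants obtained
  by averaging.\<close>

locale a4_times_c2_functions = a4_times_c2 G r1 r2 z c for G (structure) and r1 r2 z c +
  fixes w :: "'k::field" and T :: "nat \<Rightarrow> ('a \<Rightarrow> 'k) \<Rightarrow> ('a \<Rightarrow> 'k) \<Rightarrow> bool"
  assumes two: "(2::'k) \<noteq> 0" and three: "(3::'k) \<noteq> 0" and root: "w\<^sup>2 + w + 1 = 0"
    and T_const: "T d (\<lambda>_. u) (\<lambda>_. u)"
    and T_add: "T d f f' \<Longrightarrow> T d g g' \<Longrightarrow> T d (\<lambda>x. f x + g x) (\<lambda>x. f' x + g' x)"
    and T_mult: "T d f f' \<Longrightarrow> T e g g' \<Longrightarrow> T (d + e) (\<lambda>x. f x * g x) (\<lambda>x. f' x * g' x)"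
    and T_translate: "T d f f' \<Longrightarrow> h \<in> carrier G \<Longrightarrow> T d (\<lambda>g. f (h \<otimes> g)) (\<lambda>g. f' (h \<otimes> g))"
    and T_sum: "T 6 f f' \<Longrightarrow> (\<Sum>g\<in>carrier G. f g) = (\<Sum>g\<in>carrier G. f' g)"
begin

definition vals :: "'k \<Rightarrow> 'k \<Rightarrow> 'k \<Rightarrow> nat \<Rightarrow> (nat \<Rightarrow> 'k) \<Rightarrow> (nat \<Rightarrow> 'k) \<Rightarrow> bool"
  where "vals a b e d x x' \<longleftrightarrow> (\<exists>f f'. T d f f' \<and> weight a b e f \<and> weight a b e f' \<and>
    x = (\<lambda>j. f (c [^] j)) \<and> x' = (\<lambda>j. f' (c [^] j)))"

lemma valsI:
  "T d f f' \<Longrightarrow> weight a b e f \<Longrightarrow> weight a b e f' \<Longrightarrow> vals a b e d (\<lambda>j. f (c [^] j)) (\<lambda>j. f' (c [^] j))"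
  unfolding vals_def by blast

sublocale sep_core w "vals"
proof (unfold_locales, goal_cases)
  case (4 d u)
  have "weight 1 1 1 (\<lambda>_. u)" by (simp add: weight_def eig_def)
  then show ?case using valsI[OF T_const] by blast
next
  case (5 a b e d f f' g g')
  then obtain F F' H H' where
    "T d F F'" "weight a b e F" "weight a b e F'" "f = (\<lambda>j. F (c [^] j))" "f' = (\<lambda>j. F' (c [^] j))"
    "T d H H'" "weight a b e H" "weight a b e H'" "g = (\<lambda>j. H (c [^] j))" "g' = (\<lambda>j. H' (c [^] j))"
    unfolding vals_def by blast
  then show ?case
    using valsI[OF T_add, of d F F' H H' a b e] by (simp add: weight_def eig_add)
next
  case (6 a b e d f f' a2 b2 e2 d2 g g')
  then obtain F F' H H' where
    "T d F F'" "weight a b e F" "weight a b e F'" "f = (\<lambda>j. F (c [^] j))" "f' = (\<lambda>j. F' (c [^] j))"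
    "T d2 H H'" "weight a2 b2 e2 H" "weight a2 b2 e2 H'" "g = (\<lambda>j. H (c [^] j))" "g' = (\<lambda>j. H' (c [^] j))"
    unfolding vals_def by blast
  then show ?case
    using valsI[OF T_mult, of d F F' d2 H H' "a * a2" "b * b2" "e * e2"] by (simp add: weight_def eig_mult)
next
  case (7 a b e d f f')
  then obtain F F' where F:
    "T d F F'" "weight a b e F" "weight a b e F'" "f = (\<lambda>j. F (c [^] j))" "f' = (\<lambda>j. F' (c [^] j))"
    unfolding vals_def by blast
  have "c \<otimes> c [^] j = c [^] Suc j" for j :: nat
    by (rule nat_pow_Suc2[symmetric]) simp
  then show ?case
    using valsI[OF T_translate[OF F(1) closed(4)] weight_shift[OF F(2)] weight_shift[OF F(3)]]
    by (simp only: F)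
next
  case (8 a b e d f f' j)
  have "c [^] (3::nat) = \<one>"
    using cube by (simp add: numeral_3_eq_3 m_assoc)
  then have "c [^] (j + 3) = c [^] j"
    by (simp add: nat_pow_mult[symmetric])
  then show ?case using 8 unfolding vals_def by force
next
  case (9 f f')
  then obtain F F' where F:
    "T 6 F F'" "weight 1 1 1 F" "weight 1 1 1 F'" "f = (\<lambda>j. F (c [^] j))" "f' = (\<lambda>j. F' (c [^] j))"
    unfolding vals_def by blast
  have "(8::'k) = 2 * 2 * 2" by simp
  then have "(8::'k) \<noteq> 0" using two by (metis mult_eq_0_iff)
  moreover have "8 * (\<Sum>k<3. f k) = 8 * (\<Sum>k<3. f' k)"
    using T_sum[OF F(1)] weight_sum[OF F(2)] weight_sum[OF F(3)] by (simp add: F(4,5))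
  ultimately have "(\<Sum>k<3. f k) = (\<Sum>k<3. f' k)" by simp
  then show ?case by (simp add: numeral_3_eq_3 numeral_2_eq_2 lessThan_Suc add.commute add.left_commute)
qed (rule two three root)+

text \<open>On joint eigenvectors of the three involutions the exponents from
  \<open>core_characters\<close> give \<open>h\<close>. Every function is a sum of such eigenvectors
  because 2 is invertible.\<close>

theorem translate_exists: "\<exists>h\<in>carrier G. \<forall>f f'. T 1 f f' \<longrightarrow> f' \<one> = f h"
proof -
  obtain k p q l where sol: "\<And>a b e f f'. a \<in> {1, - 1} \<Longrightarrow> b \<in> {1, - 1} \<Longrightarrow> e \<in> {1, - 1} \<Longrightarrow>
      vals a b e 1 f f' \<Longrightarrow> f' 0 = a ^ p * b ^ q * e ^ l * f k"
    using core_characters by metis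
  define h where "h = r1 [^] p \<otimes> (r2 [^] q \<otimes> (z [^] l \<otimes> c [^] k))"
  have h: "h \<in> carrier G" by (simp add: h_def)
  have abe: "f' \<one> = f h"
    if T: "T 1 f f'" and w: "weight a b e f" "weight a b e f'" and "a \<in> {1, - 1}" "b \<in> {1, - 1}" "e \<in> {1, - 1}"
    for a b e f f'
    using sol[OF that(4-6) valsI[OF T w]] unfolding h_def
    by (simp add: weight_eval[OF w(1)])
  \<comment> \<open>Adding the identities for both signs eliminates one involution; this is applied
    to \<open>z\<close>, then \<open>r2\<close>, then \<open>r1\<close>.\<close>
  have split: "f' \<one> = f h"
    if "\<And>a. a \<in> {1, - 1} \<Longrightarrow> f' \<one> + a * f' (r \<otimes> \<one>) = f h + a * f (r \<otimes> h)"
    for f f' :: "'a \<Rightarrow> 'k" and r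
  proof -
    have "(f' \<one> + 1 * f' (r \<otimes> \<one>)) + (f' \<one> + (- 1) * f' (r \<otimes> \<one>)) = (f h + 1 * f (r \<otimes> h)) + (f h + (- 1) * f (r \<otimes> h))"
      by (rule arg_cong2[where f = "(+)"]; rule that; simp)
    then have "2 * f' \<one> = 2 * f h" by simp
    then show ?thesis using two by simp
  qed
  have T_project: "T 1 (\<lambda>g. f g + a * f (r \<otimes> g)) (\<lambda>g. f' g + a * f' (r \<otimes> g))"
    if "T 1 f f'" "r \<in> carrier G" for a f f' r
  proof -
    have "T 1 (\<lambda>g. a * f (r \<otimes> g)) (\<lambda>g. a * f' (r \<otimes> g))"
      using T_mult[OF T_const[of 0 a] T_translate[OF that]] by simp
    from T_add[OF that(1) this] show ?thesis .
  qed
  have ab: "f' \<one> = f h"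
    if T: "T 1 f f'" and w: "eig r1 a f" "eig r1 a f'" "eig r2 b f" "eig r2 b f'"
      and ab: "a \<in> {1, - 1}" "b \<in> {1, - 1}" for a b f f'
  proof (rule split[of _ z])
    fix e :: 'k assume e: "e \<in> {1, - 1}"
    show "f' \<one> + e * f' (z \<otimes> \<one>) = f h + e * f (z \<otimes> h)"
      by (rule abe[OF T_project[OF T closed(3), of e] _ _ ab e]; unfold weight_def; intro conjI eig_project eig_project_commute w)
        (use square e central[OF closed(1)] central[OF closed(2)] in auto)
  qed
  have a: "f' \<one> = f h"
    if T: "T 1 f f'" and w: "eig r1 a f" "eig r1 a f'" and a: "a \<in> {1, - 1}" for a f f'
  proof (rule split[of _ r2])
    fix b :: 'k assume b: "b \<in> {1, - 1}"
    show "f' \<one> + b * f' (r2 \<otimes> \<one>) = f h + b * f (r2 \<otimes> h)"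
      by (rule ab[OF T_project[OF T closed(2), of b] _ _ _ _ a b]; intro eig_project eig_project_commute w)
        (use square b commute in auto)
  qed
  have "f' \<one> = f h" if T: "T 1 f f'" for f f'
  proof (rule split[of _ r1])
    fix a :: 'k assume a': "a \<in> {1, - 1}"
    show "f' \<one> + a * f' (r1 \<otimes> \<one>) = f h + a * f (r1 \<otimes> h)"
      by (rule a[OF T_project[OF T closed(1), of a] _ _ a']; intro eig_project) (use square a' in auto)
  qed
  then show ?thesis using h by blast
qed

end

section \<open>Generators of the group\<close>

abbreviation a4c2 :: "((nat \<Rightarrow> nat) \<times> int) monoid"
  where "a4c2 \<equiv> alt_group 4 \<times>\<times> integer_mod_group 2"

text \<open>\<open>v1\<close> and \<open>v2\<close> generate the normal Klein four-group, and
  \<open>rot\<close> is a 3-cycle fixing 4.\<close>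

definition v1 :: "nat \<Rightarrow> nat" where "v1 = transpose 1 2 \<circ> transpose 3 4"
definition v2 :: "nat \<Rightarrow> nat" where "v2 = transpose 1 3 \<circ> transpose 2 4"
definition rot :: "nat \<Rightarrow> nat" where "rot = transpose 2 3 \<circ> transpose 1 2"

lemma perms_in_alt_group:
  "v1 \<in> carrier (alt_group 4)" "v2 \<in> carrier (alt_group 4)" "rot \<in> carrier (alt_group 4)"
  "id \<in> carrier (alt_group 4)"
  unfolding alt_group_carrier v1_def v2_def rot_def
  by (auto intro!: permutes_compose permutes_swap_id permutes_id
      simp: evenperm_comp permutation_swap_id evenperm_swap evenperm_id)

lemma group_a4c2: "group a4c2"
  by (intro DirProd_group alt_group_is_group group_integer_mod_group)

lemma card_a4c2: "card (carrier a4c2) = 24"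
proof -
  have "2 * card (carrier (alt_group 4)) = 24"
    using alt_group_card_carrier[of 4] by (simp add: fact_numeral)
  then show ?thesis
    by (simp add: card_cartesian_product carrier_integer_mod_group)
qed

lemma perm_relations:
  "v1 \<circ> v1 = id" "v2 \<circ> v2 = id" "rot \<circ> (rot \<circ> rot) = id" "v2 \<circ> v1 = v1 \<circ> v2"
  "rot \<circ> v1 = v2 \<circ> rot" "rot \<circ> v2 = v1 \<circ> v2 \<circ> rot"
  by (auto simp: fun_eq_iff v1_def v2_def rot_def transpose_def)

lemma perm_values:
  "v1 1 = 2" "v1 2 = 1" "v1 3 = 4" "v1 4 = 3"
  "v2 1 = 3" "v2 2 = 4" "v2 3 = 1" "v2 4 = 2"
  "rot 1 = 3" "rot 2 = 1" "rot 3 = 2" "rot 4 = 4"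
  "v1 (Suc 0) = 2" "v2 (Suc 0) = 3" "rot (Suc 0) = 3"
  by (simp_all add: v1_def v2_def rot_def transpose_def)

abbreviation (input) "gen1 \<equiv> (v1, 0 :: int)"
abbreviation (input) "gen2 \<equiv> (v2, 0 :: int)"
abbreviation (input) "genz \<equiv> (id :: nat \<Rightarrow> nat, 1 :: int)"
abbreviation (input) "genc \<equiv> (rot, 0 :: int)"

text \<open>The 2 * 2 * 2 * 3 = 24 normal forms are distinct, so by counting they exhaust the
  group.\<close>

lemma a4_times_c2_a4c2: "a4_times_c2 a4c2 gen1 gen2 genz genc"
proof -
  interpret group a4c2 by (rule group_a4c2)
  let ?S = "{..<2::nat} \<times> {..<2::nat} \<times> {..<2::nat} \<times> {..<3::nat}"
  let ?e = "\<lambda>(i, j, l, k). gen1 [^]\<^bsub>a4c2\<^esub> i \<otimes>\<^bsub>a4c2\<^esub> (gen2 [^]\<^bsub>a4c2\<^esub> j \<otimes>\<^bsub>a4c2\<^esub>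
    (genz [^]\<^bsub>a4c2\<^esub> l \<otimes>\<^bsub>a4c2\<^esub> genc [^]\<^bsub>a4c2\<^esub> k))"
  have gens: "gen1 \<in> carrier a4c2" "gen2 \<in> carrier a4c2" "genz \<in> carrier a4c2" "genc \<in> carrier a4c2"
    by (simp_all add: perms_in_alt_group carrier_integer_mod_group)
  have one: "\<one>\<^bsub>a4c2\<^esub> = (id, 0)"
    by (simp add: one_DirProd alt_group_one)
  have pow: "(p, 0) [^]\<^bsub>a4c2\<^esub> m = (p ^^ m, 0)" for p and m :: nat
    by (induction m) (simp_all add: alt_group_one alt_group_mult funpow_Suc_right fun_eq_iff del: funpow.simps(2))
  have powz: "genz [^]\<^bsub>a4c2\<^esub> m = (id, int m mod 2)" for m :: nat
  proof (induction m)
    case (Suc m)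
    have "(int m mod 2 + 1) mod 2 = int (Suc m) mod 2" by presburger
    then show ?case using Suc by (simp add: alt_group_mult fun_eq_iff)
  qed (simp add: alt_group_one id_def)
  have e: "?e (i, j, l, k) = (v1 ^^ i \<circ> (v2 ^^ j \<circ> rot ^^ k), int l mod 2)" for i j l k
    by (simp add: pow powz alt_group_mult fun_eq_iff)
  have rot4: "(rot ^^ k) 4 = 4" for k by (induction k) (simp_all add: perm_values)
  have key: "(i, j, l, k) = (i', j', l', k')"
    if lt: "i < 2" "j < 2" "l < 2" "k < 3" "i' < 2" "j' < 2" "l' < 2" "k' < 3"
      and e_eq: "?e (i, j, l, k) = ?e (i', j', l', k')" for i j l k i' j' l' k' :: nat
  proof -
    have eq: "v1 ^^ i \<circ> (v2 ^^ j \<circ> rot ^^ k) = v1 ^^ i' \<circ> (v2 ^^ j' \<circ> rot ^^ k')"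
      and l: "int l mod 2 = int l' mod 2"
      using e_eq unfolding e prod.inject by blast+
    \<comment> \<open>As \<open>rot\<close> fixes 4 and the Klein four-group is simply transitive on
      the points, the image of 4 determines \<open>i\<close> and \<open>j\<close>; the image of 1
      then determines \<open>k\<close>.\<close>
    have "(v1 ^^ i) ((v2 ^^ j) 4) = (v1 ^^ i') ((v2 ^^ j') 4)"
      using fun_cong[OF eq, of 4] by (simp add: rot4)
    then have ij: "i = i' \<and> j = j'"
      using lt by (auto simp: numeral_2_eq_2[symmetric] perm_values dest!: less_2_cases)
    have "inj v1" "inj v2"
      using perms_in_alt_group permutes_inj unfolding alt_group_carrier by blast+
    then have "inj (v1 ^^ i \<circ> v2 ^^ j)" by (intro inj_compose inj_fn)
    moreover have "(v1 ^^ i \<circ> v2 ^^ j) ((rot ^^ k) 1) = (v1 ^^ i \<circ> v2 ^^ j) ((rot ^^ k') 1)"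
      using fun_cong[OF eq, of 1] ij by simp
    ultimately have "(rot ^^ k) 1 = (rot ^^ k') 1" by (rule injD)
    moreover have "k \<in> {0, 1, 2}" "k' \<in> {0, 1, 2}" using lt by auto
    ultimately have "k = k'" by (auto simp: perm_values numeral_2_eq_2)
    then show ?thesis using ij l lt by auto
  qed
  have inj: "inj_on ?e ?S"
  proof (rule inj_onI)
    fix x y assume xy: "x \<in> ?S" "y \<in> ?S" and eq: "?e x = ?e y"
    obtain i j l k where x: "x = (i, j, l, k)" by (cases x)
    obtain i' j' l' k' where y: "y = (i', j', l', k')" by (cases y)
    show "x = y"
      unfolding x y by (rule key) (use xy[unfolded x y] eq[unfolded x y] in simp_all)
  qed
  have "?e ` ?S \<subseteq> carrier a4c2"
    using gens by (auto intro!: m_closed nat_pow_closed simp del: carrier_DirProd)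
  moreover have "card (?e ` ?S) = card (carrier a4c2)"
    using card_image[OF inj] card_a4c2 by simp
  moreover have "finite (carrier a4c2)"
    using card_a4c2 by (intro card_ge_0_finite) simp
  ultimately have "?e ` ?S = carrier a4c2" by (intro card_subset_eq)
  with inj have bij: "bij_betw ?e ?S (carrier a4c2)" by (simp add: bij_betw_def)
  show ?thesis
  proof (unfold_locales, goal_cases)
    case 13
    then show ?case by (rule bij)
  qed (use gens in \<open>auto simp: alt_group_one alt_group_mult perm_relations perm_relations(3)[unfolded o_assoc] perms_in_alt_group carrier_integer_mod_group o_assoc add.commute\<close>)
qed

section \<open>Matrix representations and averaging\<close>

lemma monom_value_const:
  "monom_value (\<lambda>_. t) m = t ^ monom_degree m"
  by (simp add: monom_value_def monom_degree_def power_sum)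

locale mat_rep = group G for G (structure) +
  fixes n :: nat and \<rho> :: "'a \<Rightarrow> 'k::field mat"
  assumes rep: "matrix_rep G n \<rho>"
begin

lemma rep_carrier [simp]: "g \<in> carrier G \<Longrightarrow> \<rho> g \<in> carrier_mat n n"
  using rep unfolding matrix_rep_def hom_def units_of_def Units_def
  by (auto simp: Pi_iff ring_mat_simps)

lemma rep_mult: "g \<in> carrier G \<Longrightarrow> h \<in> carrier G \<Longrightarrow> \<rho> (g \<otimes> h) = \<rho> g * \<rho> h"
  using rep unfolding matrix_rep_def hom_def units_of_def by (auto simp: ring_mat_simps)

lemma rep_one: "\<rho> \<one> = 1\<^sub>m n"
proof -
  interpret M: ring "ring_mat TYPE('k) n ()" by (rule ring_mat)
  have "\<rho> \<one> = \<one>\<^bsub>units_of (ring_mat TYPE('k) n ())\<^esub>"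
    using rep hom_one[of \<rho> G] M.units_group is_group unfolding matrix_rep_def by blast
  then show ?thesis by (simp add: units_of_def ring_mat_simps)
qed

lemma rep_vec: "g \<in> carrier G \<Longrightarrow> h \<in> carrier G \<Longrightarrow> v \<in> carrier_vec n \<Longrightarrow>
    \<rho> (g \<otimes> h) *\<^sub>v v = \<rho> g *\<^sub>v (\<rho> h *\<^sub>v v)"
  by (simp add: rep_mult assoc_mult_mat_vec[of _ n n _ n])

lemma rep_vec_carrier [simp]: "g \<in> carrier G \<Longrightarrow> v \<in> carrier_vec n \<Longrightarrow> \<rho> g *\<^sub>v v \<in> carrier_vec n"
  using rep_carrier by (rule mult_mat_vec_carrier)

lemma eval_act:
  assumes "p \<in> coord_ring n" "v \<in> carrier_vec n" "g \<in> carrier G"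
  shows "mpoly_eval v (poly_act G n \<rho> g p) = mpoly_eval (\<rho> (inv g) *\<^sub>v v) p"
  unfolding mpoly_eval_def poly_act_def eval_hom.subst_subst
proof (rule mpoly_subst_cong[OF assms(1)])
  fix i assume i: "i < n"
  have "\<rho> (inv g) \<in> carrier_mat n n" using assms(3) by simp
  then show "mpoly_subst (\<lambda>a. a) (\<lambda>i. v $ i) (\<Sum>j<n. mconst (\<rho> (inv g) $$ (i, j)) * mvar j) =
      (\<rho> (inv g) *\<^sub>v v) $ i"
    using assms(2) i by (auto simp: eval_hom.subst_sum scalar_prod_def lessThan_atLeast0 intro!: sum.cong)
qed

text \<open>The linear forms are composed formally, since over a finite field a polynomial is not
  determined by its values.\<close>

lemma act_act:
  assumes "p \<in> coord_ring n" "g \<in> carrier G" "h \<in> carrier G"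
  shows "poly_act G n \<rho> g (poly_act G n \<rho> h p) = poly_act G n \<rho> (g \<otimes> h) p"
  unfolding poly_act_def mconst_hom.subst_subst
proof (rule mpoly_subst_cong[OF assms(1)])
  fix i assume i: "i < n"
  have c: "\<rho> (inv g) \<in> carrier_mat n n" "\<rho> (inv h) \<in> carrier_mat n n" using assms by simp_all
  have "\<rho> (inv (g \<otimes> h)) = \<rho> (inv h) * \<rho> (inv g)"
    using assms by (simp add: inv_mult_group rep_mult)
  then have e: "\<rho> (inv (g \<otimes> h)) $$ (i, k) = (\<Sum>j<n. \<rho> (inv h) $$ (i, j) * \<rho> (inv g) $$ (j, k))" if "k < n" for k
    using c i that by (auto simp: scalar_prod_def lessThan_atLeast0 intro!: sum.cong)
  have msum: "mconst (\<Sum>j\<in>J. a j) = (\<Sum>j\<in>J. mconst (a j :: 'k))" for J :: "nat set" and a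
    by (induction J rule: infinite_finite_induct) (simp_all add: mconst_hom.zero mconst_hom.add)
  have "mpoly_subst mconst (\<lambda>i. \<Sum>j<n. mconst (\<rho> (inv g) $$ (i, j)) * mvar j)
      (\<Sum>j<n. mconst (\<rho> (inv h) $$ (i, j)) * mvar j) =
    (\<Sum>j<n. \<Sum>k<n. mconst (\<rho> (inv h) $$ (i, j)) * (mconst (\<rho> (inv g) $$ (j, k)) * mvar k))"
    by (simp add: mconst_hom.subst_sum sum_distrib_left)
  also have "\<dots> = (\<Sum>k<n. \<Sum>j<n. mconst (\<rho> (inv h) $$ (i, j)) * (mconst (\<rho> (inv g) $$ (j, k)) * mvar k))"
    by (rule sum.swap)
  also have "\<dots> = (\<Sum>k<n. mconst (\<rho> (inv (g \<otimes> h)) $$ (i, k)) * mvar k)"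
    by (intro sum.cong refl) (simp add: e msum mconst_hom.mult sum_distrib_right mult.assoc)
  finally show "mpoly_subst mconst (\<lambda>i. \<Sum>j<n. mconst (\<rho> (inv g) $$ (i, j)) * mvar j)
      (\<Sum>j<n. mconst (\<rho> (inv h) $$ (i, j)) * mvar j) =
    (\<Sum>j<n. mconst (\<rho> (inv (g \<otimes> h)) $$ (i, j)) * mvar j)" .
qed

lemma act_mpolys_le: "p \<in> mpolys_le n d \<Longrightarrow> poly_act G n \<rho> g p \<in> mpolys_le n d"
  unfolding poly_act_def
proof (rule mpolys_le_subst)
  show "(\<Sum>j<n. mconst (\<rho> (inv g) $$ (i, j)) * mvar j) \<in> mpolys_le n 1" for i
    using mpolys_le_mult[OF mpolys_le_const[of _ n 0] mpolys_le_var] by (intro mpolys_le_sum) simp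
qed

section \<open>Averaging over the group\<close>

definition reynolds :: "'k mpoly \<Rightarrow> 'k mpoly"
  where "reynolds p = (\<Sum>h\<in>carrier G. poly_act G n \<rho> h p)"

lemma reynolds_invariant:
  assumes "p \<in> mpolys_le n d"
  shows "reynolds p \<in> invariant_ring G n \<rho>" "total_degree (reynolds p) \<le> d"
proof -
  have le: "reynolds p \<in> mpolys_le n d"
    unfolding reynolds_def by (intro mpolys_le_sum act_mpolys_le assms)
  then show "total_degree (reynolds p) \<le> d" by (simp add: mpolys_le_def)
  have p: "p \<in> coord_ring n" using assms by (simp add: mpolys_le_def)
  have "poly_act G n \<rho> g (reynolds p) = reynolds p" if g: "g \<in> carrier G" for g
  proof -
    have "bij_betw (\<lambda>h. g \<otimes> h) (carrier G) (carrier G)"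
      by (rule bij_betw_byWitness[where f' = "\<lambda>h. inv g \<otimes> h"])
        (use g in \<open>auto simp: m_assoc[symmetric]\<close>)
    then have "reynolds p = (\<Sum>h\<in>carrier G. poly_act G n \<rho> (g \<otimes> h) p)"
      unfolding reynolds_def by (rule sum.reindex_bij_betw[symmetric])
    also have "\<dots> = (\<Sum>h\<in>carrier G. poly_act G n \<rho> g (poly_act G n \<rho> h p))"
      using p g by (intro sum.cong refl) (simp add: act_act)
    also have "\<dots> = poly_act G n \<rho> g (reynolds p)"
      unfolding reynolds_def poly_act_def[of G n \<rho> g] by (rule mconst_hom.subst_sum[symmetric])
    finally show ?thesis by simp
  qed
  then show "reynolds p \<in> invariant_ring G n \<rho>"
    using le by (simp add: invariant_ring_def mpolys_le_def)
qed

lemma eval_reynolds: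
  assumes "p \<in> coord_ring n" "v \<in> carrier_vec n"
  shows "mpoly_eval v (reynolds p) = (\<Sum>g\<in>carrier G. mpoly_eval (\<rho> g *\<^sub>v v) p)"
proof -
  have "mpoly_eval v (reynolds p) = (\<Sum>g\<in>carrier G. mpoly_eval v (poly_act G n \<rho> g p))"
    unfolding reynolds_def mpoly_eval_def by (rule eval_hom.subst_sum)
  also have "\<dots> = (\<Sum>g\<in>carrier G. mpoly_eval (\<rho> (inv g) *\<^sub>v v) p)"
    using assms by (intro sum.cong refl) (rule eval_act)
  also have "\<dots> = (\<Sum>g\<in>carrier G. mpoly_eval (\<rho> g *\<^sub>v v) p)"
    by (rule sum.reindex_bij_betw[where g = "\<lambda>g. mpoly_eval (\<rho> g *\<^sub>v v) p"],
        rule bij_betw_byWitness[where f' = "\<lambda>g. inv g"]) auto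
  finally show ?thesis .
qed

lemma orbit_eqI:
  assumes h: "h \<in> carrier G" and v: "v \<in> carrier_vec n"
  shows "vec_orbit G \<rho> v = vec_orbit G \<rho> (\<rho> h *\<^sub>v v)"
proof (rule Set.set_eqI, rule iffI)
  fix x assume "x \<in> vec_orbit G \<rho> v"
  then obtain g where g: "x = \<rho> g *\<^sub>v v" "g \<in> carrier G" unfolding orbit_def by blast
  then have "x = \<rho> (g \<otimes> inv h) *\<^sub>v (\<rho> h *\<^sub>v v)"
    using h v by (simp add: rep_vec[symmetric] m_assoc)
  then show "x \<in> vec_orbit G \<rho> (\<rho> h *\<^sub>v v)"
    using h g(2) unfolding orbit_def by blast
next
  fix x assume "x \<in> vec_orbit G \<rho> (\<rho> h *\<^sub>v v)"
  then obtain g where g: "x = \<rho> g *\<^sub>v (\<rho> h *\<^sub>v v)" "g \<in> carrier G" unfolding orbit_def by blast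
  then have "x = \<rho> (g \<otimes> h) *\<^sub>v v" using h v by (simp add: rep_vec)
  then show "x \<in> vec_orbit G \<rho> v"
    using h g(2) unfolding orbit_def by blast
qed

text \<open>The instance of \<open>T\<close>: one polynomial, restricted to the orbits of
  \<open>v\<close> and \<open>v'\<close> and pulled back to the group.\<close>

definition poly_functions :: "'k vec \<Rightarrow> 'k vec \<Rightarrow> nat \<Rightarrow> ('a \<Rightarrow> 'k) \<Rightarrow> ('a \<Rightarrow> 'k) \<Rightarrow> bool"
  where "poly_functions v v' d f f' \<longleftrightarrow> (\<exists>p\<in>mpolys_le n d. \<forall>g\<in>carrier G.
    f g = mpoly_eval (\<rho> g *\<^sub>v v) p \<and> f' g = mpoly_eval (\<rho> g *\<^sub>v v') p)"

lemma poly_functions_translate: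
  assumes "v \<in> carrier_vec n" "v' \<in> carrier_vec n" "h \<in> carrier G" "poly_functions v v' d f f'"
  shows "poly_functions v v' d (\<lambda>g. f (h \<otimes> g)) (\<lambda>g. f' (h \<otimes> g))"
proof -
  obtain p where p: "p \<in> mpolys_le n d" "\<And>g. g \<in> carrier G \<Longrightarrow> f g = mpoly_eval (\<rho> g *\<^sub>v v) p"
    "\<And>g. g \<in> carrier G \<Longrightarrow> f' g = mpoly_eval (\<rho> g *\<^sub>v v') p"
    using assms(4) unfolding poly_functions_def by blast
  have "mpoly_eval (\<rho> g *\<^sub>v u) (poly_act G n \<rho> (inv h) p) = mpoly_eval (\<rho> (h \<otimes> g) *\<^sub>v u) p"
    if "u \<in> carrier_vec n" "g \<in> carrier G" for u g
    using that p(1) assms(3) by (simp add: eval_act mpolys_le_def rep_vec)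
  then show ?thesis
    unfolding poly_functions_def using p assms(1-3)
    by (intro bexI[of _ "poly_act G n \<rho> (inv h) p"]) (simp_all add: act_mpolys_le)
qed

lemma poly_functions_const: "poly_functions v v' d (\<lambda>_. u) (\<lambda>_. u)"
  unfolding poly_functions_def mpoly_eval_def
  by (intro bexI[of _ "mconst u"]) simp_all

lemma poly_functions_add:
  assumes "poly_functions v v' d f f'" "poly_functions v v' d g g'"
  shows "poly_functions v v' d (\<lambda>x. f x + g x) (\<lambda>x. f' x + g' x)"
proof -
  obtain p q where "p \<in> mpolys_le n d" "q \<in> mpolys_le n d"
    "\<forall>x\<in>carrier G. f x = mpoly_eval (\<rho> x *\<^sub>v v) p \<and> f' x = mpoly_eval (\<rho> x *\<^sub>v v') p"
    "\<forall>x\<in>carrier G. g x = mpoly_eval (\<rho> x *\<^sub>v v) q \<and> g' x = mpoly_eval (\<rho> x *\<^sub>v v') q"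
    using assms unfolding poly_functions_def by blast
  then show ?thesis
    unfolding poly_functions_def
    by (intro bexI[of _ "p + q"]) (simp_all add: mpoly_eval_def mpolys_le_add)
qed

lemma poly_functions_mult:
  assumes "poly_functions v v' d f f'" "poly_functions v v' e g g'"
  shows "poly_functions v v' (d + e) (\<lambda>x. f x * g x) (\<lambda>x. f' x * g' x)"
proof -
  obtain p q where "p \<in> mpolys_le n d" "q \<in> mpolys_le n e"
    "\<forall>x\<in>carrier G. f x = mpoly_eval (\<rho> x *\<^sub>v v) p \<and> f' x = mpoly_eval (\<rho> x *\<^sub>v v') p"
    "\<forall>x\<in>carrier G. g x = mpoly_eval (\<rho> x *\<^sub>v v) q \<and> g' x = mpoly_eval (\<rho> x *\<^sub>v v') q"
    using assms unfolding poly_functions_def by blast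
  then show ?thesis
    unfolding poly_functions_def
    by (intro bexI[of _ "p * q"]) (simp_all add: mpoly_eval_def mpolys_le_mult)
qed

text \<open>Both sums are values of the invariant \<open>reynolds p\<close>, whose degree is at most
  \<open>d\<close>.\<close>

lemma poly_functions_sum:
  assumes inv: "\<And>f. f \<in> invariant_ring G n \<rho> \<Longrightarrow> total_degree f \<le> d \<Longrightarrow> mpoly_eval v f = mpoly_eval v' f"
    and v: "v \<in> carrier_vec n" "v' \<in> carrier_vec n" and f: "poly_functions v v' d f f'"
  shows "(\<Sum>g\<in>carrier G. f g) = (\<Sum>g\<in>carrier G. f' g)"
proof -
  obtain p where p: "p \<in> mpolys_le n d"
    "\<forall>x\<in>carrier G. f x = mpoly_eval (\<rho> x *\<^sub>v v) p \<and> f' x = mpoly_eval (\<rho> x *\<^sub>v v') p"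
    using f unfolding poly_functions_def by blast
  have c: "p \<in> coord_ring n" using p(1) by (simp add: mpolys_le_def)
  have "mpoly_eval v (reynolds p) = mpoly_eval v' (reynolds p)"
    using reynolds_invariant[OF p(1)] by (rule inv)
  then show ?thesis using p(2) by (simp add: eval_reynolds[OF c] v)
qed

lemma poly_functions_coordinate:
  assumes "i < n" "v \<in> carrier_vec n" "v' \<in> carrier_vec n"
  shows "poly_functions v v' 1 (\<lambda>g. (\<rho> g *\<^sub>v v) $ i) (\<lambda>g. (\<rho> g *\<^sub>v v') $ i)"
  unfolding poly_functions_def mpoly_eval_def
  by (intro bexI[of _ "mvar i"]) (use assms mpolys_le_var in auto)

end

section \<open>The separating Noether number\<close>

text \<open>From x^6 = 1 and x^3 not 1 follows x^3 = -1, which is not 1, so the characteristic is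
  not 2. Then x^2 - x + 1 = 0; in characteristic 3 the left side is (x + 1)^2, although x is not -1.
  So \<open>- x\<close> is a primitive cube root of unity.\<close>

lemma order_6_facts:
  assumes "has_mult_order (x::'k::field) 6"
  shows "x ^ 3 = - 1" "(2::'k) \<noteq> 0" "(3::'k) \<noteq> 0" "(- x)\<^sup>2 + (- x) + 1 = 0"
proof -
  have x6: "x ^ 6 = 1" and ord: "\<And>m. 0 < m \<Longrightarrow> m < 6 \<Longrightarrow> x ^ m \<noteq> 1"
    using assms unfolding has_mult_order_def by auto
  have "x ^ 6 = x ^ 3 * x ^ 3" using power_add[of x 3 3] by simp
  then have "x ^ 3 * x ^ 3 = 1" using x6 by simp
  then have "x ^ 3 = 1 \<or> x ^ 3 = - 1" by (rule square_eq_1_iff[THEN iffD1])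
  then show x3: "x ^ 3 = - 1" using ord[of 3] by auto
  show two: "(2::'k) \<noteq> 0"
  proof
    assume "(2::'k) = 0"
    then have "(1::'k) + 1 = 0" by simp
    then have "(1::'k) = - 1" by (rule eq_neg_iff_add_eq_0[THEN iffD2])
    then show False using x3 ord[of 3] by simp
  qed
  have "(x + 1) * (x\<^sup>2 - x + 1) = x ^ 3 + 1"
    by (simp add: algebra_simps power2_eq_square power3_eq_cube)
  moreover have "x \<noteq> - 1" using ord[of 2] by auto
  ultimately have q: "x\<^sup>2 - x + 1 = 0"
    using x3 by (simp add: eq_neg_iff_add_eq_0)
  then show "(- x)\<^sup>2 + (- x) + 1 = 0" by simp
  show "(3::'k) \<noteq> 0"
  proof
    assume z: "(3::'k) = 0"
    have "(x + 1)\<^sup>2 = (x\<^sup>2 - x + 1) + 3 * x" by (simp add: power2_eq_square algebra_simps)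
    then show False using q z \<open>x \<noteq> - 1\<close> by (simp add: eq_neg_iff_add_eq_0)
  qed
qed

lemma beta_sep_le_6:
  fixes \<rho> :: "(nat \<Rightarrow> nat) \<times> int \<Rightarrow> 'k::field mat"
  assumes x: "has_mult_order (x::'k) 6" and \<rho>: "matrix_rep a4c2 n \<rho>"
  shows "beta_sep a4c2 n \<rho> \<le> 6"
proof -
  interpret mat_rep a4c2 n \<rho>
    by (intro mat_rep.intro group_a4c2 mat_rep_axioms.intro \<rho>)
  let ?S = "{f \<in> invariant_ring a4c2 n \<rho>. total_degree f \<le> 6}"
  have "vec_orbit a4c2 \<rho> v = vec_orbit a4c2 \<rho> v'"
    if v: "v \<in> carrier_vec n" "v' \<in> carrier_vec n" and eq: "\<And>f. f \<in> ?S \<Longrightarrow> mpoly_eval v f = mpoly_eval v' f"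
    for v v'
  proof -
    interpret a4_times_c2 a4c2 gen1 gen2 genz genc by (rule a4_times_c2_a4c2)
    interpret a4_times_c2_functions a4c2 gen1 gen2 genz genc "- x" "poly_functions v v'"
    proof (unfold_locales, goal_cases)
      case (8 f f')
      show ?case by (rule poly_functions_sum[OF _ v 8]) (use eq in blast)
    qed (fact order_6_facts[OF x] poly_functions_const poly_functions_add poly_functions_mult
        | (rule poly_functions_translate[OF v]; assumption))+
    obtain h where h: "h \<in> carrier a4c2" "\<And>f f'. poly_functions v v' 1 f f' \<Longrightarrow> f' \<one>\<^bsub>a4c2\<^esub> = f h"
      using translate_exists by blast
    have "v' = \<rho> h *\<^sub>v v"
    proof (rule eq_vecI)
      fix i assume "i < dim_vec (\<rho> h *\<^sub>v v)"
      then have i: "i < n" using rep_carrier[OF h(1)] by simp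
      \<comment> \<open>Coordinate functions have degree 1, so \<open>h\<close> takes every
        coordinate of \<open>v\<close> to that of \<open>v'\<close>.\<close>
      have "(\<rho> \<one>\<^bsub>a4c2\<^esub> *\<^sub>v v') $ i = (\<rho> h *\<^sub>v v) $ i"
        by (rule h(2)[OF poly_functions_coordinate[OF i v]])
      then show "v' $ i = (\<rho> h *\<^sub>v v) $ i" using v(2) unfolding rep_one by simp
    qed (use v(2) rep_carrier[OF h(1)] in simp)
    then show ?thesis using orbit_eqI[OF h(1) v(1)] by simp
  qed
  then have "separating_set a4c2 n \<rho> ?S"
    unfolding separating_set_def by blast
  then have "enat 6 \<in> {enat d | d. 0 < d \<and> separating_set a4c2 n \<rho> {f \<in> invariant_ring a4c2 n \<rho>. total_degree f \<le> d}}"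
    by force
  then show ?thesis
    unfolding beta_sep_def numeral_eq_enat by (rule Inf_lower)
qed

section \<open>The lower bound: a character of order 6\<close>

text \<open>
  The image of \<open>p\<close> in \<open>C\<^sub>3\<close> is its effect on the three partitions of \<open>{1, 2, 3, 4}\<close> into pairs.
  The partition with a part \<open>{p 3, p 4}\<close> is recognised by the sum of that part, which is
  \<open>3\<close> or \<open>7\<close>, \<open>4\<close> or \<open>6\<close>, or \<open>5\<close>.
\<close>

definition pairing_char :: "'k::field \<Rightarrow> nat \<Rightarrow> 'k"
  where "pairing_char w s = (if s = 5 then w\<^sup>2 else if even s then w else 1)"

definition char6 :: "'k::field \<Rightarrow> (nat \<Rightarrow> nat) \<times> int \<Rightarrow> 'k"
  where "char6 w = (\<lambda>(p, s). pairing_char w (p 3 + p 4) * (- 1) ^ nat s)"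

lemma (in a4_times_c2) generator_induct:
  assumes "g \<in> carrier G" "P \<one>"
    and step: "\<And>r h. r \<in> {r1, r2, z, c} \<Longrightarrow> h \<in> carrier G \<Longrightarrow> P h \<Longrightarrow> P (r \<otimes> h)"
  shows "P g"
proof -
  have pow: "P (r [^] (m::nat) \<otimes> h)" if r: "r \<in> {r1, r2, z, c}" and h: "h \<in> carrier G" "P h" for r m h
  proof (induction m)
    case (Suc m)
    have r': "r \<in> carrier G" using r by auto
    have "r [^] Suc m \<otimes> h = r \<otimes> (r [^] m \<otimes> h)"
      using r' h by (simp only: nat_pow_Suc2 m_assoc nat_pow_closed)
    then show ?case using step[OF r _ Suc] r' h by simp
  qed (use h in simp)
  obtain i j l k :: nat where "g = r1 [^] i \<otimes> (r2 [^] j \<otimes> (z [^] l \<otimes> c [^] k))"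
    using assms(1) enum unfolding bij_betw_def by force
  moreover have "P (c [^] k \<otimes> \<one>)" by (rule pow) (use assms(2) in auto)
  ultimately show ?thesis by (auto intro!: pow)
qed

text \<open>\<open>v1\<close> and \<open>v2\<close> fix each of the three partitions into pairs,
  while \<open>rot\<close> permutes them cyclically.\<close>

lemma pairing_char_generators:
  assumes "w ^ 3 = (1::'k::field)" and "i \<in> {1, 2, 3, 4}" "j \<in> {1, 2, 3, 4}" "i \<noteq> j"
  shows "pairing_char w (v1 i + v1 j) = pairing_char w (i + j)"
    "pairing_char w (v2 i + v2 j) = pairing_char w (i + j)"
    "pairing_char w (rot i + rot j) = w * pairing_char w (i + j)"
proof -
  have w: "w * (w * w) = 1" using assms(1) by (simp add: power3_eq_cube mult.assoc)
  show "pairing_char w (v1 i + v1 j) = pairing_char w (i + j)"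
    "pairing_char w (v2 i + v2 j) = pairing_char w (i + j)"
    "pairing_char w (rot i + rot j) = w * pairing_char w (i + j)"
    using assms(2-4)
    by (elim insertE emptyE; simp add: pairing_char_def perm_values power2_eq_square w)+
qed

lemma char6_generators:
  assumes w: "w ^ 3 = (1::'k::field)" and g: "g \<in> carrier a4c2"
  shows "char6 w (gen1 \<otimes>\<^bsub>a4c2\<^esub> g) = char6 w g" "char6 w (gen2 \<otimes>\<^bsub>a4c2\<^esub> g) = char6 w g"
    "char6 w (genz \<otimes>\<^bsub>a4c2\<^esub> g) = - char6 w g" "char6 w (genc \<otimes>\<^bsub>a4c2\<^esub> g) = w * char6 w g"
proof -
  obtain p s where gps: "g = (p, s)" by (cases g)
  have "p permutes {1..4}" using g by (simp add: gps alt_group_carrier)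
  moreover have "0 \<le> s \<and> s < 2" using g by (simp add: gps carrier_integer_mod_group)
  then have "s = 0 \<or> s = 1" by linarith
  ultimately have ps: "g = (p, s)" "p permutes {1..4}" "s = 0 \<or> s = 1" using gps by blast+
  have "p 3 \<in> {1..4}" "p 4 \<in> {1..4}" "p 3 \<noteq> p 4"
    using permutes_in_image[OF ps(2)] inj_eq[OF permutes_inj[OF ps(2)]] by auto
  then have "p 3 \<in> {1, 2, 3, 4}" "p 4 \<in> {1, 2, 3, 4}" "p 3 \<noteq> p 4" by auto
  note pairing_char_generators[OF w this]
  then show "char6 w (gen1 \<otimes>\<^bsub>a4c2\<^esub> g) = char6 w g" "char6 w (gen2 \<otimes>\<^bsub>a4c2\<^esub> g) = char6 w g"
    "char6 w (genz \<otimes>\<^bsub>a4c2\<^esub> g) = - char6 w g" "char6 w (genc \<otimes>\<^bsub>a4c2\<^esub> g) = w * char6 w g"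
    using ps(3) by (auto simp: ps(1) char6_def alt_group_mult)
qed

text \<open>Left multiplication by a generator scales \<open>char6\<close> by a constant, so
  induction over products of generators suffices.\<close>

lemma char6_mult:
  assumes w: "w ^ 3 = (1::'k::field)" and g: "g \<in> carrier a4c2" and h: "h \<in> carrier a4c2"
  shows "char6 w (g \<otimes>\<^bsub>a4c2\<^esub> h) = char6 w g * char6 w h"
proof -
  interpret a4_times_c2 a4c2 gen1 gen2 genz genc by (rule a4_times_c2_a4c2)
  note gen = char6_generators[OF w]
  have one: "char6 w \<one>\<^bsub>a4c2\<^esub> = 1"
    by (simp add: char6_def pairing_char_def alt_group_one)
  show ?thesis
    using g
  proof (rule generator_induct[where P = "\<lambda>g. char6 w (g \<otimes>\<^bsub>a4c2\<^esub> h) = char6 w g * char6 w h"])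
    show "char6 w (\<one>\<^bsub>a4c2\<^esub> \<otimes>\<^bsub>a4c2\<^esub> h) = char6 w \<one>\<^bsub>a4c2\<^esub> * char6 w h"
      using h one by (metis l_one mult_1)
  next
    fix r k assume r: "r \<in> {gen1, gen2, genz, genc}" and k: "k \<in> carrier a4c2"
      and IH: "char6 w (k \<otimes>\<^bsub>a4c2\<^esub> h) = char6 w k * char6 w h"
    have "r \<otimes>\<^bsub>a4c2\<^esub> k \<otimes>\<^bsub>a4c2\<^esub> h = r \<otimes>\<^bsub>a4c2\<^esub> (k \<otimes>\<^bsub>a4c2\<^esub> h)"
      using r k h closed by (intro m_assoc) auto
    moreover have "k \<otimes>\<^bsub>a4c2\<^esub> h \<in> carrier a4c2" using k h by (rule m_closed)
    ultimately show "char6 w (r \<otimes>\<^bsub>a4c2\<^esub> k \<otimes>\<^bsub>a4c2\<^esub> h) = char6 w (r \<otimes>\<^bsub>a4c2\<^esub> k) * char6 w h"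
      using r gen[of k] gen[of "k \<otimes>\<^bsub>a4c2\<^esub> h"] k IH by (elim insertE emptyE) (simp_all only: mult.assoc mult_minus_left)
  qed
qed

definition rep6 :: "'k::field \<Rightarrow> (nat \<Rightarrow> nat) \<times> int \<Rightarrow> 'k mat"
  where "rep6 w g = mat 1 1 (\<lambda>_. char6 w g)"

lemma matrix_rep_rep6:
  assumes "w ^ 3 = (1::'k::field)"
  shows "matrix_rep a4c2 1 (rep6 w)"
proof -
  interpret group a4c2 by (rule group_a4c2)
  have mult: "rep6 w (g \<otimes>\<^bsub>a4c2\<^esub> h) = rep6 w g * rep6 w h" if "g \<in> carrier a4c2" "h \<in> carrier a4c2" for g h
    unfolding rep6_def char6_mult[OF assms that] by (rule eq_matI) (auto simp: scalar_prod_def)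
  have one: "rep6 w \<one>\<^bsub>a4c2\<^esub> = 1\<^sub>m 1"
    by (rule eq_matI) (auto simp: rep6_def char6_def pairing_char_def alt_group_one)
  have "rep6 w g \<in> Units (ring_mat TYPE('k) 1 ())" if g: "g \<in> carrier a4c2" for g
  proof -
    have "rep6 w g * rep6 w (inv\<^bsub>a4c2\<^esub> g) = 1\<^sub>m 1" "rep6 w (inv\<^bsub>a4c2\<^esub> g) * rep6 w g = 1\<^sub>m 1"
      using g mult[of g "inv\<^bsub>a4c2\<^esub> g"] mult[of "inv\<^bsub>a4c2\<^esub> g" g] one r_inv[OF g] l_inv[OF g] inv_closed[OF g]
      by metis+
    moreover have "rep6 w k \<in> carrier_mat 1 1" for k by (simp add: rep6_def)
    ultimately show ?thesis unfolding Units_def ring_mat_simps by blast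
  qed
  then show ?thesis
    using mult unfolding matrix_rep_def hom_def units_of_def by (auto simp: ring_mat_simps)
qed

text \<open>Since 0^0 = 1, the right side is 6 for \<open>m = 0\<close> and 0 otherwise; in this
  form it later reads as an evaluation at 0.\<close>

lemma sum_powers_root:
  assumes "has_mult_order (x::'k::field) 6" "m < 6"
  shows "(\<Sum>i<6. (x ^ i) ^ m) = 6 * 0 ^ m"
proof (cases "m = 0")
  case False
  have "x ^ m \<noteq> 1" "x ^ 6 = 1" using assms False unfolding has_mult_order_def by auto
  moreover have "(x ^ m) ^ 6 = (x ^ 6) ^ m" by (simp only: power_mult[symmetric] mult.commute)
  ultimately have "(\<Sum>i<6. (x ^ m) ^ i) = 0"
    using geometric_sum[of "x ^ m" 6] by simp
  moreover have "(x ^ i) ^ m = (x ^ m) ^ i" for i by (simp only: power_mult[symmetric] mult.commute)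
  ultimately show ?thesis using False by simp
qed simp

text \<open>An invariant takes the same value at all powers of \<open>x\<close>. The average of a
  polynomial of degree less than 6 over them is its value at 0, so it cannot separate 1 from
  0.\<close>

lemma beta_sep_rep6_ge:
  assumes x: "has_mult_order (x::'k::field) 6"
  shows "6 \<le> beta_sep a4c2 1 (rep6 (- x))"
proof -
  note facts = order_6_facts[OF x]
  let ?\<rho> = "rep6 (- x)"
  have w: "(- x) ^ 3 = 1" using facts(1) by simp
  interpret mat_rep a4c2 1 ?\<rho>
    by (intro mat_rep.intro group_a4c2 mat_rep_axioms.intro matrix_rep_rep6 w)
  define u where "u t = vec 1 (\<lambda>_. t)" for t :: 'k
  have u: "u t \<in> carrier_vec 1" for t by (simp add: u_def)
  have \<rho>u: "?\<rho> g *\<^sub>v u t = u (char6 (- x) g * t)" for g t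
    by (rule eq_vecI) (auto simp: rep6_def u_def scalar_prod_def)
  \<comment> \<open>This element acts as multiplication by \<open>x\<close>: \<open>rot\<close>
    contributes \<open>- x\<close> and the factor of order 2 the sign -1.\<close>
  define g0 where "g0 = (rot, 1 :: int)"
  have g0: "g0 \<in> carrier a4c2" "char6 (- x) g0 = x"
    by (simp_all add: g0_def perms_in_alt_group carrier_integer_mod_group char6_def pairing_char_def perm_values)
  have False if d: "d < 6" and sep: "separating_set a4c2 1 ?\<rho> {f \<in> invariant_ring a4c2 1 ?\<rho>. total_degree f \<le> d}" for d
  proof -
    have "u 1 \<in> vec_orbit a4c2 ?\<rho> (u 1)"
      unfolding orbit_def using rep_one u[of 1] one_closed by (metis (mono_tags, lifting) mem_Collect_eq one_mult_mat_vec)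
    moreover have "u 1 \<notin> vec_orbit a4c2 ?\<rho> (u 0)"
      unfolding orbit_def by (auto simp: \<rho>u) (auto simp: u_def vec_eq_iff)
    ultimately obtain f where f: "f \<in> invariant_ring a4c2 1 ?\<rho>" "total_degree f \<le> d" "mpoly_eval (u 1) f \<noteq> mpoly_eval (u 0) f"
      using sep u unfolding separating_set_def by blast
    have c: "f \<in> coord_ring 1" and le: "f \<in> mpolys_le 1 d" using f by (auto simp: invariant_ring_def mpolys_le_def)
    have val: "mpoly_eval (u t) f = (\<Sum>m\<in>Poly_Mapping.keys f. Poly_Mapping.lookup f m * t ^ monom_degree m)" for t
    proof -
      have "mpoly_eval (u t) f = mpoly_subst (\<lambda>a. a) (\<lambda>_. t) f"
        unfolding mpoly_eval_def by (rule mpoly_subst_cong[OF c]) (simp add: u_def)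
      then show ?thesis by (simp add: mpoly_subst_eq monom_value_const)
    qed
    have step: "mpoly_eval (u (x * t)) f = mpoly_eval (u t) f" for t
    proof -
      \<comment> \<open>The action on polynomials involves the inverse, so invariance is used for
        \<open>inv g0\<close>.\<close>
      have "mpoly_eval (?\<rho> (inv\<^bsub>a4c2\<^esub> (inv\<^bsub>a4c2\<^esub> g0)) *\<^sub>v u t) f = mpoly_eval (u t) (poly_act a4c2 1 ?\<rho> (inv\<^bsub>a4c2\<^esub> g0) f)"
        by (rule eval_act[symmetric, OF c u inv_closed[OF g0(1)]])
      also have "poly_act a4c2 1 ?\<rho> (inv\<^bsub>a4c2\<^esub> g0) f = f"
        using f(1) inv_closed[OF g0(1)] unfolding invariant_ring_def by blast
      finally show ?thesis unfolding inv_inv[OF g0(1)] \<rho>u g0(2) .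
    qed
    have pow: "mpoly_eval (u (x ^ i)) f = mpoly_eval (u 1) f" for i
      by (induction i) (simp_all add: step)
    have "6 * mpoly_eval (u 1) f = (\<Sum>i<6. mpoly_eval (u (x ^ i)) f)"
      by (simp add: pow)
    also have "\<dots> = (\<Sum>m\<in>Poly_Mapping.keys f. Poly_Mapping.lookup f m * (\<Sum>i<6. (x ^ i) ^ monom_degree m))"
      unfolding val sum_distrib_left by (rule sum.swap)
    also have "\<dots> = (\<Sum>m\<in>Poly_Mapping.keys f. Poly_Mapping.lookup f m * (6 * 0 ^ monom_degree m))"
      using le d by (intro sum.cong refl arg_cong2[where f = "(*)"] sum_powers_root[OF x]) (auto simp: mpolys_le_iff)
    also have "\<dots> = 6 * mpoly_eval (u 0) f"
      unfolding val sum_distrib_left by (simp add: mult.left_commute)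
    finally have "6 * mpoly_eval (u 1) f = 6 * mpoly_eval (u 0) f" .
    moreover have "(6::'k) = 2 * 3" by simp
    ultimately show False using f(3) facts(2,3) by (metis mult_cancel_left mult_eq_0_iff)
  qed
  then have "d \<ge> 6" if "separating_set a4c2 1 ?\<rho> {f \<in> invariant_ring a4c2 1 ?\<rho>. total_degree f \<le> d}" for d
    using that not_less by blast
  then show ?thesis
    unfolding beta_sep_def numeral_eq_enat by (intro Inf_greatest) auto
qed

theorem theorem4p10:
  assumes "\<exists>x :: 'k::field. has_mult_order x 6"
  shows "beta_sep_field TYPE('k) (alt_group 4 \<times>\<times> integer_mod_group 2) = 6"
proof -
  obtain x :: 'k where x: "has_mult_order x 6" using assms by blast
  have w: "(- x) ^ 3 = 1" using order_6_facts(1)[OF x] by simp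
  show ?thesis
  proof (rule antisym)
    show "beta_sep_field TYPE('k) a4c2 \<le> 6"
      unfolding beta_sep_field_def by (rule Sup_least) (use beta_sep_le_6[OF x] in blast)
    have "6 \<le> beta_sep a4c2 1 (rep6 (- x))" by (rule beta_sep_rep6_ge[OF x])
    also have "\<dots> \<le> beta_sep_field TYPE('k) a4c2"
      unfolding beta_sep_field_def by (rule Sup_upper) (use matrix_rep_rep6[OF w] in blast)
    finally show "6 \<le> beta_sep_field TYPE('k) a4c2" .
  qed
qed

end
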